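(* Under the standing assumptions, suppose in addition that $\Theta_{2,n}(a)$ is invertible. Then for every $z\in\mathbb C\setminus\{a,b\}$, \begin{align*} U^{(2n)}(z)=&\begin{pmatrix}\frac{1}{(b-z)(z-a)}I_q&0_q\\0_q&I_q\end{pmatrix}\Bigg[\overrightarrow{\prod_{k=0}^{n-1}}\begin{pmatrix}I_q&(z-a)\mathbf l_{k-1}\\0_q&I_q\end{pmatrix}\begin{pmatrix}I_q&0_q\\-\mathbf m_k&I_q\end{pmatrix}\Bigg]\begin{pmatrix}I_q&(z-a)\mathbf l_{n-1}\\0_q&I_q\end{pmatrix}\\ &\cdot\begin{pmatrix}I_q&0_q\\ Q_{2,n-1}(a)^{-1}P_{2,n-1}(a)+\frac{1}{b-a}\Theta_{2,n}(a)^{-1}\Gamma_{2,n}(a)&I_q\end{pmatrix}\begin{pmatrix}(b-a)(z-a)I_q&0_q\\0_q&\frac{b-z}{b-a}I_q\end{pmatrix}, \end{align*} where $\overrightarrow{\prod_{k=0}^{n-1}}A_k:=A_0A_1\cdots A_{n-1}$.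
   Context: Let $q,n\in\mathbb N$ and let $a<b$ be real numbers. All matrices are complex; $I_q$, $0_q$ are the $q\times q$ identity and zero matrices; for a matrix-valued function $F$, $F^*(\bar z)$ means $(F(\bar z))^*$. Let $s_0,\dots,s_{2n+1}$ be Hermitian $q\times q$ matrices and set $\widehat s_j:=-ab\,s_j+(a+b)s_{j+1}-s_{j+2}$. Define $H_{1,j}:=(s_{l+k})_{l,k=0}^j$, $H_{2,j}:=(\widehat s_{l+k})_{l,k=0}^{j}$, $K_{1,j}:=(bs_{l+k}-s_{l+k+1})_{l,k=0}^{j}$, $K_{2,j}:=(-as_{l+k}+s_{l+k+1})_{l,k=0}^j$. Standing assumption: $H_{1,n},H_{2,n-1},K_{1,n},K_{2,n}$ are positive definite. Let $T_0:=0_q$ and, for $j\ge1$, let $T_j$ be the $(j+1)\times(j+1)$ block matrix (blocks $q\times q$) with $I_q$ in block positions $(l+1,l)$, $l=0,\dots,j-1$, and $0_q$ elsewhere; $R_j(z):=(I_{(j+1)q}-zT_j)^{-1}$; $v_j:=\mathrm{col}(I_q,0_q,\dots,0_q)\in\mathbb C^{(j+1)q\times q}$. Let $u_{2,0}:=-(a+b)s_0+s_1$, $u_{2,j}:=\mathrm{col}(u_{2,0},-\widehat s_0,\dots,-\widehat s_{j-1})$, $\widetilde u_{1,j}:=\mathrm{col}(s_0,s_1-bs_0,\dots,s_j-bs_{j-1})$, $\widetilde u_{2,j}:=\mathrm{col}(-s_0,as_0-s_1,\dots,as_{j-1}-s_j)$; for $j\ge1$, $Y_{2,j}:=\mathrm{col}(\widehat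 s_j,\dots,\widehat s_{2j-1})$, $\widetilde Y_{1,j}:=\mathrm{col}(bs_j-s_{j+1},\dots,bs_{2j-1}-s_{2j})$, $\widetilde Y_{2,j}:=\mathrm{col}(-as_j+s_{j+1},\dots,-as_{2j-1}+s_{2j})$. Polynomials: $P_{2,0}:=I_q$, $Q_{2,0}(z):=-(u_{2,0}+zs_0)$, $\Gamma_{1,0}=\Gamma_{2,0}:=I_q$, $\Theta_{1,0}:=s_0$, $\Theta_{2,0}:=-s_0$; for $j\ge1$: $P_{2,j}(z):=(-Y_{2,j}^*H_{2,j-1}^{-1},I_q)R_j(z)v_j$, $Q_{2,j}(z):=-(-Y_{2,j}^*H_{2,j-1}^{-1},I_q)R_j(z)(u_{2,j}+zv_js_0)$, and for $k\in\{1,2\}$: $\Gamma_{k,j}(z):=(-\widetilde Y_{k,j}^*K_{k,j-1}^{-1},I_q)R_j(z)v_j$, $\Theta_{k,j}(z):=(-\widetilde Y_{k,j}^*K_{k,j-1}^{-1},I_q)R_j(z)\widetilde u_{k,j}$. DSM parameters: $\lambda_j:=(u_{2,j}+av_js_0)^*R_j(a)^*H_{2,j}^{-1}R_j(a)(u_{2,j}+av_js_0)$, $\mu_j:=v_j^*R_j(a)^*K_{1,j}^{-1}R_j(a)v_j$; $\mathbf l_{-1}:=s_0$, $\mathbf l_0:=\lambda_0$, $\mathbf l_j:=\lambda_j-\lambda_{j-1}$ ($1\le j\le n-1$); $\mathbf m_0:=\mu_0$, $\mathbf m_j:=\mu_j-\mu_{j-1}$ ($1\le j\le n$). Resolvent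 matrix (even case): $U^{(2n)}(z):=\begin{pmatrix}\Theta_{2,n}^*(\bar z)\Theta_{2,n}(a)^{*-1} & \frac{1}{b-a}\Theta_{1,n}^*(\bar z)\Gamma_{1,n}(a)^{*-1}\\ (z-a)\Gamma_{2,n}^*(\bar z)\Theta_{2,n}(a)^{*-1} & \frac{b-z}{b-a}\Gamma_{1,n}^*(\bar z)\Gamma_{1,n}(a)^{*-1}\end{pmatrix}$, where $X^{*-1}:=(X^* )^{-1}$ (the invertibility of $\Gamma_{1,n}(a)$ and $Q_{2,n-1}(a)$ holds under the standing assumptions). *)

theory Defs
  imports Complex_Main "Jordan_Normal_Form.Schur_Decomposition"
begin

(* All matrices are complex JNF matrices ('complex mat'). Block matrices with
   (j+1) x (j+1) blocks of size q x q are represented as ordinary matrices of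
   size (j+1)q x (j+1)q; block (l,k) occupies rows l*q..l*q+q-1, cols k*q..k*q+q-1. *)

definition hermitian_mat :: "complex mat \<Rightarrow> bool" where
  "hermitian_mat A \<longleftrightarrow> square_mat A \<and> mat_adjoint A = A"

definition posdef_mat :: "complex mat \<Rightarrow> bool" where
  "posdef_mat A \<longleftrightarrow> hermitian_mat A \<and>
     (\<forall>v \<in> carrier_vec (dim_row A). v \<noteq> 0\<^sub>v (dim_row A) \<longrightarrow> 0 < conjugate v \<bullet> (A *\<^sub>v v))"

(* matrix inverse (meaningful for invertible square matrices) *)
definition minv :: "complex mat \<Rightarrow> complex mat" where
  "minv A = (SOME B. B \<in> carrier_mat (dim_row A) (dim_row A) \<and>
                    A * B = 1\<^sub>m (dim_row A) \<and> B * A = 1\<^sub>m (dim_row A))"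

definition blk_hankel :: "nat \<Rightarrow> (nat \<Rightarrow> complex mat) \<Rightarrow> nat \<Rightarrow> complex mat" where
  "blk_hankel q f j = mat (Suc j * q) (Suc j * q)
     (\<lambda>(r, c). f (r div q + c div q) $$ (r mod q, c mod q))"

definition blk_col :: "nat \<Rightarrow> nat \<Rightarrow> (nat \<Rightarrow> complex mat) \<Rightarrow> complex mat" where
  "blk_col q m f = mat (m * q) q (\<lambda>(r, c). f (r div q) $$ (r mod q, c))"

definition blk_row_I :: "nat \<Rightarrow> complex mat \<Rightarrow> complex mat" where
  "blk_row_I q X = mat q (dim_col X + q)
     (\<lambda>(r, c). if c < dim_col X then X $$ (r, c) else if c - dim_col X = r then 1 else 0)"

definition shat :: "real \<Rightarrow> real \<Rightarrow> (nat \<Rightarrow> complex mat) \<Rightarrow> nat \<Rightarrow> complex mat" where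
  "shat a b s j = (- complex_of_real (a * b)) \<cdot>\<^sub>m s j + complex_of_real (a + b) \<cdot>\<^sub>m s (Suc j) - s (Suc (Suc j))"

definition H1 :: "nat \<Rightarrow> (nat \<Rightarrow> complex mat) \<Rightarrow> nat \<Rightarrow> complex mat" where
  "H1 q s j = blk_hankel q s j"
definition H2 :: "nat \<Rightarrow> real \<Rightarrow> real \<Rightarrow> (nat \<Rightarrow> complex mat) \<Rightarrow> nat \<Rightarrow> complex mat" where
  "H2 q a b s j = blk_hankel q (shat a b s) j"
definition K1 :: "nat \<Rightarrow> real \<Rightarrow> (nat \<Rightarrow> complex mat) \<Rightarrow> nat \<Rightarrow> complex mat" where
  "K1 q b s j = blk_hankel q (\<lambda>i. complex_of_real b \<cdot>\<^sub>m s i - s (Suc i)) j"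
definition K2 :: "nat \<Rightarrow> real \<Rightarrow> (nat \<Rightarrow> complex mat) \<Rightarrow> nat \<Rightarrow> complex mat" where
  "K2 q a s j = blk_hankel q (\<lambda>i. - (complex_of_real a \<cdot>\<^sub>m s i) + s (Suc i)) j"

definition Tmat :: "nat \<Rightarrow> nat \<Rightarrow> complex mat" where
  "Tmat q j = mat (Suc j * q) (Suc j * q)
     (\<lambda>(r, c). if r div q = Suc (c div q) \<and> r mod q = c mod q then 1 else 0)"

definition Rmat :: "nat \<Rightarrow> nat \<Rightarrow> complex \<Rightarrow> complex mat" where
  "Rmat q j z = minv (1\<^sub>m (Suc j * q) - z \<cdot>\<^sub>m Tmat q j)"

definition vvec :: "nat \<Rightarrow> nat \<Rightarrow> complex mat" where
  "vvec q j = blk_col q (Suc j) (\<lambda>i. if i = 0 then 1\<^sub>m q else 0\<^sub>m q q)"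

definition u20 :: "real \<Rightarrow> real \<Rightarrow> (nat \<Rightarrow> complex mat) \<Rightarrow> complex mat" where
  "u20 a b s = - (complex_of_real (a + b) \<cdot>\<^sub>m s 0) + s 1"

definition u2 :: "nat \<Rightarrow> real \<Rightarrow> real \<Rightarrow> (nat \<Rightarrow> complex mat) \<Rightarrow> nat \<Rightarrow> complex mat" where
  "u2 q a b s j = blk_col q (Suc j) (\<lambda>i. if i = 0 then u20 a b s else - shat a b s (i - 1))"

definition ut1 :: "nat \<Rightarrow> real \<Rightarrow> (nat \<Rightarrow> complex mat) \<Rightarrow> nat \<Rightarrow> complex mat" where
  "ut1 q b s j = blk_col q (Suc j)
     (\<lambda>i. if i = 0 then s 0 else s i - complex_of_real b \<cdot>\<^sub>m s (i - 1))"

definition ut2 :: "nat \<Rightarrow> real \<Rightarrow> (nat \<Rightarrow> complex mat) \<Rightarrow> nat \<Rightarrow> complex mat" where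
  "ut2 q a s j = blk_col q (Suc j)
     (\<lambda>i. if i = 0 then - s 0 else complex_of_real a \<cdot>\<^sub>m s (i - 1) - s i)"

(* for j >= 1 *)
definition Y2 :: "nat \<Rightarrow> real \<Rightarrow> real \<Rightarrow> (nat \<Rightarrow> complex mat) \<Rightarrow> nat \<Rightarrow> complex mat" where
  "Y2 q a b s j = blk_col q j (\<lambda>i. shat a b s (j + i))"
definition Yt1 :: "nat \<Rightarrow> real \<Rightarrow> (nat \<Rightarrow> complex mat) \<Rightarrow> nat \<Rightarrow> complex mat" where
  "Yt1 q b s j = blk_col q j (\<lambda>i. complex_of_real b \<cdot>\<^sub>m s (j + i) - s (Suc (j + i)))"
definition Yt2 :: "nat \<Rightarrow> real \<Rightarrow> (nat \<Rightarrow> complex mat) \<Rightarrow> nat \<Rightarrow> complex mat" where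
  "Yt2 q a s j = blk_col q j (\<lambda>i. - (complex_of_real a \<cdot>\<^sub>m s (j + i)) + s (Suc (j + i)))"

definition P2 :: "nat \<Rightarrow> real \<Rightarrow> real \<Rightarrow> (nat \<Rightarrow> complex mat) \<Rightarrow> nat \<Rightarrow> complex \<Rightarrow> complex mat" where
  "P2 q a b s j z = (if j = 0 then 1\<^sub>m q else
     blk_row_I q (- (mat_adjoint (Y2 q a b s j) * minv (H2 q a b s (j - 1)))) * Rmat q j z * vvec q j)"

definition Q2 :: "nat \<Rightarrow> real \<Rightarrow> real \<Rightarrow> (nat \<Rightarrow> complex mat) \<Rightarrow> nat \<Rightarrow> complex \<Rightarrow> complex mat" where
  "Q2 q a b s j z = (if j = 0 then - (u20 a b s + z \<cdot>\<^sub>m s 0) else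
     - (blk_row_I q (- (mat_adjoint (Y2 q a b s j) * minv (H2 q a b s (j - 1)))) * Rmat q j z
         * (u2 q a b s j + z \<cdot>\<^sub>m (vvec q j * s 0))))"

definition Gam1 :: "nat \<Rightarrow> real \<Rightarrow> (nat \<Rightarrow> complex mat) \<Rightarrow> nat \<Rightarrow> complex \<Rightarrow> complex mat" where
  "Gam1 q b s j z = (if j = 0 then 1\<^sub>m q else
     blk_row_I q (- (mat_adjoint (Yt1 q b s j) * minv (K1 q b s (j - 1)))) * Rmat q j z * vvec q j)"
definition Gam2 :: "nat \<Rightarrow> real \<Rightarrow> (nat \<Rightarrow> complex mat) \<Rightarrow> nat \<Rightarrow> complex \<Rightarrow> complex mat" where
  "Gam2 q a s j z = (if j = 0 then 1\<^sub>m q else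
     blk_row_I q (- (mat_adjoint (Yt2 q a s j) * minv (K2 q a s (j - 1)))) * Rmat q j z * vvec q j)"
definition The1 :: "nat \<Rightarrow> real \<Rightarrow> (nat \<Rightarrow> complex mat) \<Rightarrow> nat \<Rightarrow> complex \<Rightarrow> complex mat" where
  "The1 q b s j z = (if j = 0 then s 0 else
     blk_row_I q (- (mat_adjoint (Yt1 q b s j) * minv (K1 q b s (j - 1)))) * Rmat q j z * ut1 q b s j)"
definition The2 :: "nat \<Rightarrow> real \<Rightarrow> (nat \<Rightarrow> complex mat) \<Rightarrow> nat \<Rightarrow> complex \<Rightarrow> complex mat" where
  "The2 q a s j z = (if j = 0 then - s 0 else
     blk_row_I q (- (mat_adjoint (Yt2 q a s j) * minv (K2 q a s (j - 1)))) * Rmat q j z * ut2 q a s j)"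

definition lam :: "nat \<Rightarrow> real \<Rightarrow> real \<Rightarrow> (nat \<Rightarrow> complex mat) \<Rightarrow> nat \<Rightarrow> complex mat" where
  "lam q a b s j = (let w = u2 q a b s j + complex_of_real a \<cdot>\<^sub>m (vvec q j * s 0);
                        R = Rmat q j (complex_of_real a)
                    in mat_adjoint w * mat_adjoint R * minv (H2 q a b s j) * R * w)"

definition mu :: "nat \<Rightarrow> real \<Rightarrow> real \<Rightarrow> (nat \<Rightarrow> complex mat) \<Rightarrow> nat \<Rightarrow> complex mat" where
  "mu q a b s j = (let R = Rmat q j (complex_of_real a)
                   in mat_adjoint (vvec q j) * mat_adjoint R * minv (K1 q b s j) * R * vvec q j)"

definition lbf :: "nat \<Rightarrow> real \<Rightarrow> real \<Rightarrow> (nat \<Rightarrow> complex mat) \<Rightarrow> int \<Rightarrow> complex mat" where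
  "lbf q a b s j = (if j = -1 then s 0 else if j = 0 then lam q a b s 0
                    else lam q a b s (nat j) - lam q a b s (nat j - 1))"

definition mbf :: "nat \<Rightarrow> real \<Rightarrow> real \<Rightarrow> (nat \<Rightarrow> complex mat) \<Rightarrow> nat \<Rightarrow> complex mat" where
  "mbf q a b s j = (if j = 0 then mu q a b s 0 else mu q a b s j - mu q a b s (j - 1))"

(* resolvent matrix U^(2n)(z); the inverse of the adjoint; F-star at conj z is the adjoint of F (cnj z) *)
definition U2n :: "nat \<Rightarrow> real \<Rightarrow> real \<Rightarrow> (nat \<Rightarrow> complex mat) \<Rightarrow> nat \<Rightarrow> complex \<Rightarrow> complex mat" where
  "U2n q a b s n z = four_block_mat
     (mat_adjoint (The2 q a s n (cnj z)) * minv (mat_adjoint (The2 q a s n (complex_of_real a))))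
     (complex_of_real (1 / (b - a)) \<cdot>\<^sub>m
        (mat_adjoint (The1 q b s n (cnj z)) * minv (mat_adjoint (Gam1 q b s n (complex_of_real a)))))
     ((z - complex_of_real a) \<cdot>\<^sub>m
        (mat_adjoint (Gam2 q a s n (cnj z)) * minv (mat_adjoint (The2 q a s n (complex_of_real a)))))
     (((complex_of_real b - z) / complex_of_real (b - a)) \<cdot>\<^sub>m
        (mat_adjoint (Gam1 q b s n (cnj z)) * minv (mat_adjoint (Gam1 q b s n (complex_of_real a)))))"

definition mat_prod_list :: "nat \<Rightarrow> complex mat list \<Rightarrow> complex mat" where
  "mat_prod_list d As = foldr (*) As (1\<^sub>m d)"

abbreviation blk2 :: "complex mat \<Rightarrow> complex mat \<Rightarrow> complex mat \<Rightarrow> complex mat \<Rightarrow> complex mat" where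
  "blk2 A B C D \<equiv> four_block_mat A B C D"

end

(* Taking adjoints, every entry of U(z) becomes a row of matrix coefficients applied to a column
   of powers or second kind polynomials in w = cnj z. Let kappa_l = b s_l - s_{l+1}, let f_k be the
   row of degree k with <f_k, kappa_{.+m}> = a^m for m <= k, let e_k solve
   <e_k, shat_{.+m}> = kappa_m for m <= k, and put G_k = 1 - (X - a) e_{k-1}. Then
   mu_k = f_k(a), lambda_k = <e_k, kappa>, and orthogonality together with the regularity of the
   Hankel matrices gives
     f_k - f_{k-1} = m_k G_k,   e_k - e_{k-1} = l_k f_k,
   which are exactly the recurrences produced by multiplying the elementary factors one by one.
   The same uniqueness argument identifies Gamma_{1,n} = Gamma_{1,n}(a) G_n,
   P_{2,n-1} = Q_{2,n-1}(a) f_{n-1} and Gamma_{2,n} = Theta_{2,n}(a) J with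
   <J, s_{.+m}> = -a^m, and finally J / (b - a) + f_{n-1} = S G_n, where S is the lower left entry
   of the last triangular factor: both sides are orthogonal to kappa and agree at a. *)

theory Submission
  imports Defs
begin

section \<open>Block rows and Hankel systems\<close>

text \<open>The adjoint is taken because only a, b and z commute with the moments: a linear system
  then fixes a row up to a factor on the left, and the adjoint of each entry of U is, up to a
  scalar, a left quotient Y(a)^{-1} X(w) in which that factor cancels. The price is that l_k, m_k
  and the last lower left entry must be known to be Hermitian; each is traced back to quadratic
  forms in inverse Hankel matrices. Two dual uniqueness principles carry everything. A row
  orthogonal to kappa is divided by X - a, and its quotient is forced to be a left multiple of e, so
  the row equals its value at a times G. A row orthogonal to the differences x_{l+1} - a x_l of a
  sequence x pairs with the shifts of x as a geometric progression of ratio a, so it is a left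
  multiple of the solution with right-hand side a^m. The second principle applies to both remaining
  weights, since shat_l = kappa_{l+1} - a kappa_l, while K_2 is built from s_{l+1} - a s_l. A row
  stands for a polynomial with coefficients on the left. Identities are stated for its pairing with
  every sequence, so that one identity yields values at a or w, second kind polynomials and leading
  coefficients.\<close>

definition row_dot :: "nat \<Rightarrow> (nat \<Rightarrow> 'a::ring_1) \<Rightarrow> (nat \<Rightarrow> 'a) \<Rightarrow> 'a" where
  "row_dot k c x = (\<Sum>l<k. c l * x l)"

text \<open>Consecutive rows have different lengths; extension by zero lets them be
  subtracted.\<close>

definition row_pad :: "nat \<Rightarrow> (nat \<Rightarrow> 'a::ring_1) \<Rightarrow> nat \<Rightarrow> 'a" where
  "row_pad k c l = (if l < k then c l else 0)"

lemma row_dot_add_left: "row_dot k (\<lambda>l. c l + d l) x = row_dot k c x + row_dot k d x"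
  by (simp add: row_dot_def sum.distrib distrib_right)

lemma row_dot_diff_left: "row_dot k (\<lambda>l. c l - d l) x = row_dot k c x - row_dot k d x"
  by (simp add: row_dot_def sum_subtractf left_diff_distrib)

lemma row_dot_uminus_left: "row_dot k (\<lambda>l. - c l) x = - row_dot k c x"
  by (simp add: row_dot_def sum_negf)

lemma row_dot_uminus_right: "row_dot k c (\<lambda>l. - x l) = - row_dot k c x"
  by (simp add: row_dot_def sum_negf)

lemma row_dot_mult_left: "row_dot k (\<lambda>l. u * c l) x = u * row_dot k c x"
  by (simp add: row_dot_def sum_distrib_left mult.assoc)

lemma row_dot_add_right: "row_dot k c (\<lambda>l. x l + y l) = row_dot k c x + row_dot k c y"
  by (simp add: row_dot_def sum.distrib distrib_left)

lemma row_dot_diff_right: "row_dot k c (\<lambda>l. x l - y l) = row_dot k c x - row_dot k c y"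
  by (simp add: row_dot_def sum_subtractf right_diff_distrib)

lemma row_dot_central_right:
  assumes "\<And>x. t * x = x * t"
  shows "row_dot k c (\<lambda>l. t * x l) = t * row_dot k c x"
  unfolding row_dot_def sum_distrib_left
  by (rule sum.cong) (simp, metis mult.assoc assms)

lemma row_dot_pad:
  assumes "k \<le> n"
  shows "row_dot n (row_pad k c) x = row_dot k c x"
proof -
  have "(\<Sum>l<n. row_pad k c l * x l) = (\<Sum>l<k. row_pad k c l * x l)"
    using assms by (intro sum.mono_neutral_right) (auto simp: row_pad_def)
  also have "\<dots> = (\<Sum>l<k. c l * x l)"
    by (rule sum.cong) (auto simp: row_pad_def)
  finally show ?thesis by (simp add: row_dot_def)
qed

lemma row_dot_cong: "(\<And>l. l < k \<Longrightarrow> x l = y l) \<Longrightarrow> row_dot k c x = row_dot k c y"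
  by (auto simp: row_dot_def intro: sum.cong)

lemma row_dot_Suc: "row_dot (Suc k) c x = row_dot k c x + c k * x k"
  by (simp add: row_dot_def)

text \<open>Pairing with the unit sequence at \<open>k\<close> isolates leading coefficients; a
  leading coefficient 1 on the left will make \<open>u\<close> invertible from the right.\<close>

lemma row_dot_eq_coeff:
  assumes "\<And>x. row_dot (Suc k) c x = u * row_dot (Suc k) d x"
  shows "c k = u * d k"
  using assms[of "\<lambda>l. if l = k then 1 else 0"] by (simp add: row_dot_def if_distrib cong: if_cong)

text \<open>Division of the polynomial \<open>d\<close> by X - a: pairing with the powers of
  \<open>a\<close> is the remainder, and passing from \<open>x\<close> to its differences is
  multiplication by X - a.\<close>

lemma row_dot_divide:
  fixes a :: "'a::ring_1"
  assumes "\<And>x. a * x = x * a"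
  shows "\<exists>e. \<forall>x. row_dot (Suc k) d x =
    row_dot (Suc k) d (\<lambda>l. a ^ l) * x 0 + row_dot k e (\<lambda>l. x (Suc l) - a * x l)"
proof (induction k arbitrary: d)
  case 0
  then show ?case by (simp add: row_dot_def)
next
  case (Suc k)
  \<comment> \<open>The top term splits as d X^{k+1} = d (X - a) X^k + d a X^k; the second part
    joins the coefficient of X^k. On the powers of \<open>a\<close> the first part vanishes, so the
    remainder is unchanged.\<close>
  define d' where "d' = d(k := d k + d (Suc k) * a)"
  have low: "row_dot k d' x = row_dot k d x" for x
    by (auto simp: row_dot_def d'_def intro: sum.cong)
  have red: "row_dot (Suc (Suc k)) d x =
      row_dot (Suc k) d' x + d (Suc k) * (x (Suc k) - a * x k)" for x
    by (simp add: row_dot_Suc low) (simp add: d'_def algebra_simps)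
  obtain e where e: "\<And>x. row_dot (Suc k) d' x =
      row_dot (Suc k) d' (\<lambda>l. a ^ l) * x 0 + row_dot k e (\<lambda>l. x (Suc l) - a * x l)"
    using Suc.IH by blast
  define e' where "e' = e(k := d (Suc k))"
  have "row_dot (Suc k) e' y = row_dot k e y + d (Suc k) * y k" for y
    by (auto simp: row_dot_def e'_def intro: sum.cong)
  then have "\<forall>x. row_dot (Suc (Suc k)) d x = row_dot (Suc (Suc k)) d (\<lambda>l. a ^ l) * x 0
      + row_dot (Suc k) e' (\<lambda>l. x (Suc l) - a * x l)"
    by (simp add: red[of "\<lambda>l. a ^ l"]) (simp add: red e[symmetric])
  then show ?case by blast
qed

text \<open>A right inverse is enough for rows: if c H = 0 then c = c H X = 0. For
  \<open>k = 0\<close> the condition is vacuous, which lets the recurrences start from empty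
  rows.\<close>

definition hankel_regular :: "(nat \<Rightarrow> 'a::ring_1) \<Rightarrow> nat \<Rightarrow> bool" where
  "hankel_regular \<sigma> k \<longleftrightarrow>
    (\<exists>X. \<forall>i<k. \<forall>j<k. (\<Sum>l<k. \<sigma> (i + l) * X l j) = (if i = j then 1 else 0))"

lemma hankel_regular_row_zero:
  assumes "hankel_regular \<sigma> k"
    and zero: "\<And>m. m < k \<Longrightarrow> row_dot k c (\<lambda>l. \<sigma> (l + m)) = 0"
  shows "row_dot k c x = 0"
proof -
  obtain X where X: "\<And>i j. i < k \<Longrightarrow> j < k \<Longrightarrow>
      (\<Sum>l<k. \<sigma> (i + l) * X l j) = (if i = j then 1 else 0)"
    using assms(1) unfolding hankel_regular_def by blast
  have "c j = 0" if j: "j < k" for j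
  proof -
    have "c j = (\<Sum>i<k. c i * (\<Sum>l<k. \<sigma> (i + l) * X l j))"
      using j by (simp add: X if_distrib cong: if_cong)
    also have "\<dots> = (\<Sum>i<k. \<Sum>l<k. c i * \<sigma> (i + l) * X l j)"
      by (simp add: sum_distrib_left mult.assoc)
    also have "\<dots> = (\<Sum>l<k. row_dot k c (\<lambda>i. \<sigma> (i + l)) * X l j)"
      by (subst sum.swap) (simp add: row_dot_def sum_distrib_right)
    also have "\<dots> = 0" by (simp add: zero)
    finally show ?thesis .
  qed
  then show ?thesis by (simp add: row_dot_def)
qed

text \<open>The \<open>k\<close> orthogonality relations say that pairing with the next shift
  multiplies by \<open>a\<close>, so the pairings with shifts 0 to \<open>k\<close> are u a^m,
  exactly those of \<open>u * f\<close>. Here \<open>f\<close> is the kernel polynomial at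
  \<open>a\<close> of the moments \<open>\<sigma>\<close>.\<close>

lemma annihilator_of_differences:
  fixes a :: "'a::ring_1"
  assumes central: "\<And>x. a * x = x * a"
    and reg: "hankel_regular \<sigma> (Suc k)"
    and f: "\<And>m. m \<le> k \<Longrightarrow> row_dot (Suc k) f (\<lambda>l. \<sigma> (l + m)) = a ^ m"
    and c: "\<And>m. m < k \<Longrightarrow> row_dot (Suc k) c (\<lambda>l. \<sigma> (Suc (l + m)) - a * \<sigma> (l + m)) = 0"
  shows "row_dot (Suc k) c x = row_dot (Suc k) c \<sigma> * row_dot (Suc k) f x"
proof -
  define u where "u = row_dot (Suc k) c \<sigma>"
  have pow: "row_dot (Suc k) c (\<lambda>l. \<sigma> (l + m)) = u * a ^ m" if "m \<le> k" for m
    using that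
  proof (induction m)
    case 0
    then show ?case by (simp add: u_def)
  next
    case (Suc m)
    then have "row_dot (Suc k) c (\<lambda>l. \<sigma> (l + Suc m)) = a * row_dot (Suc k) c (\<lambda>l. \<sigma> (l + m))"
      using c[of m] by (simp add: row_dot_diff_right row_dot_central_right[OF central])
    also have "\<dots> = u * a ^ Suc m"
      using Suc by (simp add: central[of "u * a ^ m"] power_commutes mult.assoc)
    finally show ?case .
  qed
  have "row_dot (Suc k) (\<lambda>l. c l - u * f l) x = 0"
    by (rule hankel_regular_row_zero[OF reg])
      (simp add: row_dot_diff_left row_dot_mult_left pow f)
  then show ?thesis by (simp add: row_dot_diff_left row_dot_mult_left u_def)
qed

text \<open>The rows \<open>F k\<close> and \<open>E k\<close> have length \<open>k\<close>, so that the value \<open>M (k + 1)\<close> of \<open>F (k + 1)\<close> at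
  \<open>a\<close> becomes \<open>\<mu>\<^sub>k\<close> and \<open>L (k + 1)\<close> becomes \<open>\<lambda>\<^sub>k\<close>, with \<open>M 0 = L 0 = 0\<close>.\<close>

locale moment_rows =
  fixes a b :: "'a::ring_1" and s :: "nat \<Rightarrow> 'a" and F E :: "nat \<Rightarrow> nat \<Rightarrow> 'a" and n :: nat
  assumes a_central: "\<And>x. a * x = x * a" and b_central: "\<And>x. b * x = x * b"
    and regular_b: "\<And>k. k < n \<Longrightarrow> hankel_regular (\<lambda>l. b * s l - s (Suc l)) (Suc k)"
    and regular_ab: "\<And>k. k \<le> n \<Longrightarrow>
      hankel_regular (\<lambda>l. b * s (Suc l) - s (Suc (Suc l)) - a * (b * s l - s (Suc l))) k"
    and F: "\<And>k m. k \<le> n \<Longrightarrow> m < k \<Longrightarrow>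
      row_dot k (F k) (\<lambda>l. b * s (l + m) - s (Suc (l + m))) = a ^ m"
    and E: "\<And>k m. k \<le> n \<Longrightarrow> m < k \<Longrightarrow>
      row_dot k (E k) (\<lambda>l. b * s (Suc (l + m)) - s (Suc (Suc (l + m)))
        - a * (b * s (l + m) - s (Suc (l + m)))) = b * s m - s (Suc m)"
begin

definition \<kappa> :: "nat \<Rightarrow> 'a" where "\<kappa> l = b * s l - s (Suc l)"

text \<open>Pairing with the polynomial 1 - (X - a) \<open>E k\<close>, of degree at most
  \<open>k\<close>. For \<open>k \<le> n\<close> it vanishes on the shifts of
  \<open>\<kappa>\<close> by less than \<open>k\<close> and is 1 on the powers of \<open>a\<close>:
  an orthogonal polynomial normalised at \<open>a\<close> instead of at its leading
  coefficient.\<close>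

definition G :: "nat \<Rightarrow> (nat \<Rightarrow> 'a) \<Rightarrow> 'a" where
  "G k x = x 0 - row_dot k (E k) (\<lambda>l. x (Suc l) - a * x l)"

definition M :: "nat \<Rightarrow> 'a" where "M k = row_dot k (F k) (\<lambda>l. a ^ l)"

definition L :: "nat \<Rightarrow> 'a" where "L k = row_dot k (E k) \<kappa>"

lemma regular_\<kappa>: "k < n \<Longrightarrow> hankel_regular \<kappa> (Suc k)"
  using regular_b by (simp add: \<kappa>_def[abs_def])

lemma regular_\<kappa>_diff: "k \<le> n \<Longrightarrow> hankel_regular (\<lambda>l. \<kappa> (Suc l) - a * \<kappa> l) k"
  using regular_ab by (simp add: \<kappa>_def)

lemma F_\<kappa>: "k \<le> n \<Longrightarrow> m < k \<Longrightarrow> row_dot k (F k) (\<lambda>l. \<kappa> (l + m)) = a ^ m"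
  using F by (simp add: \<kappa>_def)

lemma E_\<kappa>: "k \<le> n \<Longrightarrow> m < k \<Longrightarrow>
    row_dot k (E k) (\<lambda>l. \<kappa> (Suc (l + m)) - a * \<kappa> (l + m)) = \<kappa> m"
  using E by (simp add: \<kappa>_def)

text \<open>A row of length \<open>k + 1\<close> is read as a polynomial of degree at most \<open>k\<close>. Dividing by
  \<open>X - a\<close> turns orthogonality to \<open>\<kappa>\<close> into a linear system for the quotient which the
  regularity of the Hankel matrix of \<open>\<kappa> (l + 1) - a \<kappa> l\<close> solves uniquely.\<close>

lemma annihilator_of_\<kappa>:
  assumes k: "k \<le> n"
    and c: "\<And>m. m < k \<Longrightarrow> row_dot (Suc k) c (\<lambda>l. \<kappa> (l + m)) = 0"
  shows "row_dot (Suc k) c x = row_dot (Suc k) c (\<lambda>l. a ^ l) * G k x"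
proof -
  define u where "u = row_dot (Suc k) c (\<lambda>l. a ^ l)"
  obtain e where e: "\<And>x. row_dot (Suc k) c x =
      u * x 0 + row_dot k e (\<lambda>l. x (Suc l) - a * x l)"
    using row_dot_divide[OF a_central, of k c] unfolding u_def by blast
  have "row_dot k (\<lambda>l. e l + u * E k l) x = 0" for x
  proof (rule hankel_regular_row_zero[OF regular_\<kappa>_diff[OF k]])
    fix m assume "m < k"
    then show "row_dot k (\<lambda>l. e l + u * E k l) (\<lambda>l. \<kappa> (Suc (l + m)) - a * \<kappa> (l + m)) = 0"
      using c[of m] e[of "\<lambda>l. \<kappa> (l + m)"] k
      by (simp add: row_dot_add_left row_dot_mult_left E_\<kappa> add.commute)
  qed
  then have quot: "row_dot k e x = - (u * row_dot k (E k) x)" for x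
    by (simp add: row_dot_add_left row_dot_mult_left eq_neg_iff_add_eq_0)
  show ?thesis
    unfolding u_def[symmetric] e[of x] quot G_def by (simp add: right_diff_distrib)
qed

text \<open>The leading coefficient 1 factors as the value of \<open>c\<close> at \<open>a\<close>
  times the leading coefficient of \<open>G n\<close>, so that value has a right inverse.\<close>

lemma annihilator_normalised:
  assumes c: "\<And>m. m < n \<Longrightarrow> row_dot (Suc n) c (\<lambda>l. \<kappa> (l + m)) = 0" and top: "c n = 1"
  shows "\<exists>X. row_dot (Suc n) c (\<lambda>l. a ^ l) * X = 1"
proof -
  have "row_dot (Suc n) c (\<lambda>l. if l = n then 1 else 0) = 1"
    by (simp add: row_dot_def top if_distrib cong: if_cong)
  then show ?thesis using annihilator_of_\<kappa>[OF order_refl c] by metis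
qed

text \<open>Both rows pair with the shift of \<open>\<kappa>\<close> by m < k to a^m, so their
  difference is orthogonal to \<open>\<kappa>\<close> and is governed by its value at
  \<open>a\<close>.\<close>

lemma F_step:
  assumes "k < n"
  shows "row_dot (Suc k) (F (Suc k)) x = row_dot k (F k) x + (M (Suc k) - M k) * G k x"
proof -
  have "row_dot (Suc k) (\<lambda>l. F (Suc k) l - row_pad k (F k) l) x =
      row_dot (Suc k) (\<lambda>l. F (Suc k) l - row_pad k (F k) l) (\<lambda>l. a ^ l) * G k x"
    using assms by (intro annihilator_of_\<kappa>) (simp_all add: row_dot_diff_left row_dot_pad F_\<kappa>)
  then show ?thesis
    by (simp add: row_dot_diff_left row_dot_pad M_def algebra_simps)
qed

text \<open>Both rows solve the equations with right-hand side \<open>\<kappa> m\<close> for m < k,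
  so their difference kills the differences of \<open>\<kappa>\<close> and must be a left multiple
  of the kernel row \<open>F (Suc k)\<close>; pairing with \<open>\<kappa>\<close> itself gives the
  factor.\<close>

lemma E_step:
  assumes k: "k < n"
  shows "row_dot (Suc k) (E (Suc k)) x =
    row_dot k (E k) x + (L (Suc k) - L k) * row_dot (Suc k) (F (Suc k)) x"
proof -
  have "row_dot (Suc k) (\<lambda>l. E (Suc k) l - row_pad k (E k) l) x =
      row_dot (Suc k) (\<lambda>l. E (Suc k) l - row_pad k (E k) l) \<kappa> * row_dot (Suc k) (F (Suc k)) x"
    using k
    by (intro annihilator_of_differences[OF a_central regular_\<kappa>])
      (simp_all add: row_dot_diff_left row_dot_pad F_\<kappa> E_\<kappa>)
  then show ?thesis
    by (simp add: row_dot_diff_left row_dot_pad L_def algebra_simps)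
qed

lemma G_step:
  assumes "k < n"
  shows "G (Suc k) x = G k x -
    (L (Suc k) - L k) * row_dot (Suc k) (F (Suc k)) (\<lambda>l. x (Suc l) - a * x l)"
  by (simp add: G_def E_step[OF assms] algebra_simps)

end

section \<open>Recurrences for the rows evaluated at a central element z\<close>

locale moment_rows_at = moment_rows a b s F E n
  for a b :: "'a::ring_1" and s F E n +
  fixes z :: 'a
  assumes z_central: "\<And>x. z * x = x * z"
begin

text \<open>\<open>\<theta>\<close> and \<open>t\<close> are the block entries of R(z) applied to
  the columns \<open>ut1\<close> and \<open>ut2\<close>; paired with the coefficient rows of Gamma_1
  and Gamma_2 they give Theta_1 and Theta_2.\<close>

primrec \<theta> :: "nat \<Rightarrow> 'a" where
  "\<theta> 0 = s 0"
| "\<theta> (Suc l) = z * \<theta> l - \<kappa> l"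

primrec t :: "nat \<Rightarrow> 'a" where
  "t 0 = - s 0"
| "t (Suc l) = z * t l - (s (Suc l) - a * s l)"

text \<open>For positive \<open>k \<le> n\<close> this is minus the pairing of \<open>F k\<close>
  with \<open>\<theta> (Suc l) - a * \<theta> l\<close>: those differences are
  \<open>(z - a) * \<theta> l - \<kappa> l\<close>, and \<open>F k\<close> pairs with
  \<open>\<kappa>\<close> to 1. The constant also supplies the initial value 1 at
  \<open>k = 0\<close>.\<close>

definition Q :: "nat \<Rightarrow> 'a" where "Q k = 1 - (z - a) * row_dot k (F k) \<theta>"

definition P :: "nat \<Rightarrow> 'a" where "P k = row_dot k (F k) (\<lambda>l. z ^ l)"

lemma za_central: "(z - a) * x = x * (z - a)"
  by (simp add: algebra_simps a_central z_central)

lemma bz_central: "(b - z) * x = x * (b - z)"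
  by (simp add: algebra_simps b_central z_central)

lemma Q_0: "Q 0 = 1" by (simp add: Q_def row_dot_def)

lemma P_0: "P 0 = 0" by (simp add: P_def row_dot_def)

lemma G_\<theta>_0: "G 0 \<theta> = s 0" by (simp add: G_def row_dot_def)

lemma G_power_0: "G 0 (\<lambda>l. z ^ l) = 1" by (simp add: G_def row_dot_def)

lemma P_step: "k < n \<Longrightarrow> P (Suc k) = P k + (M (Suc k) - M k) * G k (\<lambda>l. z ^ l)"
  by (simp add: P_def F_step)

lemma Q_step:
  assumes "k < n"
  shows "Q (Suc k) = Q k - (M (Suc k) - M k) * ((z - a) * G k \<theta>)"
proof -
  have "(z - a) * ((M (Suc k) - M k) * G k \<theta>) = (M (Suc k) - M k) * ((z - a) * G k \<theta>)"
    by (metis za_central mult.assoc)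
  then show ?thesis
    by (simp only: Q_def F_step[OF assms] distrib_left diff_diff_eq)
qed

lemma G_power_step:
  assumes "k < n"
  shows "G (Suc k) (\<lambda>l. z ^ l) = G k (\<lambda>l. z ^ l) - (z - a) * (L (Suc k) - L k) * P (Suc k)"
proof -
  have "row_dot (Suc k) (F (Suc k)) (\<lambda>l. z ^ Suc l - a * z ^ l) = (z - a) * P (Suc k)"
    unfolding P_def row_dot_central_right[OF za_central, symmetric]
    by (simp add: left_diff_distrib)
  then show ?thesis
    by (simp add: G_step[OF assms]) (metis za_central mult.assoc)
qed

lemma G_\<theta>_step:
  assumes "k < n"
  shows "G (Suc k) \<theta> = G k \<theta> + (L (Suc k) - L k) * Q (Suc k)"
proof -
  have "(\<lambda>l. \<theta> (Suc l) - a * \<theta> l) = (\<lambda>l. (z - a) * \<theta> l - \<kappa> l)"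
    by (simp add: algebra_simps)
  then have "row_dot (Suc k) (F (Suc k)) (\<lambda>l. \<theta> (Suc l) - a * \<theta> l) =
      (z - a) * row_dot (Suc k) (F (Suc k)) \<theta> - 1"
    using F_\<kappa>[of "Suc k" 0] assms
    by (simp only: row_dot_diff_right row_dot_central_right[OF za_central]) simp
  then show ?thesis
    by (simp only: G_step[OF assms] Q_def) (simp add: algebra_simps)
qed

text \<open>Both sides satisfy the recurrence \<open>y (l + 1) = z y l + (\<kappa> (l + 1) - a \<kappa> l)\<close>: they are the
  second kind polynomials for the weight \<open>(b - x)(x - a)\<close>.\<close>

lemma \<theta>_t: "\<kappa> l - (z - a) * \<theta> l = - ((b - z) * t l) - (s (Suc l) - a * s l)"
proof (induction l)
  case 0
  then show ?case by (simp add: \<kappa>_def algebra_simps)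
next
  case (Suc l)
  have "\<kappa> (Suc l) - (z - a) * \<theta> (Suc l) =
      z * (\<kappa> l - (z - a) * \<theta> l) + (\<kappa> (Suc l) - a * \<kappa> l)"
    by (simp add: algebra_simps) (metis a_central mult.assoc)
  also have "\<dots> = z * (- ((b - z) * t l) - (s (Suc l) - a * s l)) + (\<kappa> (Suc l) - a * \<kappa> l)"
    by (simp only: Suc.IH)
  also have "\<dots> = - ((b - z) * t (Suc l)) - (s (Suc (Suc l)) - a * s (Suc l))"
    by (simp add: algebra_simps \<kappa>_def) (metis a_central b_central mult.assoc)
  finally show ?case .
qed

end

text \<open>\<open>J\<close> is minus the kernel polynomial at \<open>a\<close> of the moments
  \<open>s\<close>. The sign is that of R(a) applied to \<open>ut2\<close>, whose blocks are -s_l;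
  with it Gamma_2 is Theta_2(a) times \<open>J\<close> without a further sign.\<close>

locale moment_rows_final = moment_rows_at a b s F E n z
  for a b :: "'a::ring_1" and s F E n z +
  fixes J :: "nat \<Rightarrow> 'a"
  assumes J: "\<And>m. m \<le> n \<Longrightarrow> row_dot (Suc n) J (\<lambda>l. s (l + m)) = - (a ^ m)"
begin

text \<open>This is b - a times the lower left entry of the last triangular factor; the scaling
  avoids division in a general ring.\<close>

definition S :: 'a where "S = row_dot (Suc n) J (\<lambda>l. a ^ l) + (b - a) * M n"

text \<open>On the shift of \<open>\<kappa>\<close> by m < n, \<open>J\<close> gives b (-a^m) +
  a^{m+1} = -(b - a) a^m, which \<open>(b - a) * F n\<close> cancels. The sum is therefore
  orthogonal to \<open>\<kappa>\<close>, and \<open>S\<close> is its value at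
  \<open>a\<close>.\<close>

lemma S_G:
  "S * G n x = row_dot (Suc n) J x + (b - a) * row_dot n (F n) x"
proof -
  have J\<kappa>: "row_dot (Suc n) J (\<lambda>l. \<kappa> (l + m)) = - ((b - a) * a ^ m)" if "m < n" for m
    using that J[of m] J[of "Suc m"]
    by (simp add: \<kappa>_def row_dot_diff_right row_dot_central_right[OF b_central] algebra_simps)
  have "row_dot (Suc n) (\<lambda>l. J l + (b - a) * row_pad n (F n) l) x =
      row_dot (Suc n) (\<lambda>l. J l + (b - a) * row_pad n (F n) l) (\<lambda>l. a ^ l) * G n x"
    by (rule annihilator_of_\<kappa>)
      (simp_all add: row_dot_add_left row_dot_mult_left row_dot_pad F_\<kappa> J\<kappa>)
  then show ?thesis
    by (simp add: row_dot_add_left row_dot_mult_left row_dot_pad S_def M_def)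
qed

lemma S_G_power: "S * G n (\<lambda>l. z ^ l) - (b - a) * P n = row_dot (Suc n) J (\<lambda>l. z ^ l)"
  by (simp add: S_G P_def)

text \<open>By \<open>\<theta>_t\<close>, (z - a) \<theta> equals (b - z) t + (b - a) s. Since
  \<open>J\<close> pairs with s to -1, the resulting -(b - a) cancels the constant hidden in
  \<open>Q n\<close>. This is the upper left entry of U up to b - z.\<close>

lemma S_G_\<theta>: "(b - a) * Q n + S * ((z - a) * G n \<theta>) = (b - z) * row_dot (Suc n) J t"
proof -
  have "S * ((z - a) * G n \<theta>) = (z - a) * (S * G n \<theta>)"
    by (metis za_central mult.assoc)
  also have "\<dots> = row_dot (Suc n) J (\<lambda>l. (z - a) * \<theta> l) + (b - a) * (1 - Q n)"
  proof -
    have "(z - a) * ((b - a) * row_dot n (F n) \<theta>) = (b - a) * ((z - a) * row_dot n (F n) \<theta>)"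
      by (metis za_central mult.assoc)
    then show ?thesis
      by (simp only: S_G distrib_left row_dot_central_right[OF za_central])
        (simp add: Q_def)
  qed
  also have "(\<lambda>l. (z - a) * \<theta> l) = (\<lambda>l. (b - z) * t l + (b - a) * s l)"
  proof
    fix l
    have "(z - a) * \<theta> l = \<kappa> l + (b - z) * t l + (s (Suc l) - a * s l)"
      using \<theta>_t[of l] by (simp add: algebra_simps)
    then show "(z - a) * \<theta> l = (b - z) * t l + (b - a) * s l"
      by (simp add: \<kappa>_def algebra_simps)
  qed
  also have "row_dot (Suc n) J (\<lambda>l. (b - z) * t l + (b - a) * s l) =
      (b - z) * row_dot (Suc n) J t - (b - a)"
  proof -
    have ba: "(b - a) * x = x * (b - a)" for x
      by (simp add: algebra_simps a_central b_central)
    show ?thesis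
      using J[of 0]
      by (simp add: row_dot_add_right row_dot_central_right[OF bz_central]
          row_dot_central_right[OF ba])
  qed
  finally show ?thesis by (simp add: algebra_simps)
qed

end

section \<open>Matrices as operators on sequences\<close>

text \<open>Matrices of a fixed size form no type, so the ring computations take place in the ring of
  linear operators on sequences: a \<open>q \<times> q\<close> block acts simultaneously on all
  consecutive segments of length \<open>q\<close>.\<close>

typedef seq_op = "{f :: (nat \<Rightarrow> complex) \<Rightarrow> nat \<Rightarrow> complex.
    (\<forall>x y. f (\<lambda>i. x i + y i) = (\<lambda>i. f x i + f y i)) \<and> (\<forall>c x. f (\<lambda>i. c * x i) = (\<lambda>i. c * f x i))}"
  morphisms op_apply Seq_op
  by (rule exI[of _ "\<lambda>x. x"]) simp

setup_lifting type_definition_seq_op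

lemma seq_op_eqI: "(\<And>x i. op_apply f x i = op_apply g x i) \<Longrightarrow> f = g"
  by (simp add: op_apply_inject[symmetric] fun_eq_iff)

instantiation seq_op :: ring_1
begin

lift_definition zero_seq_op :: seq_op is "\<lambda>x i. 0" by simp
lift_definition one_seq_op :: seq_op is "\<lambda>x. x" by simp
lift_definition plus_seq_op :: "seq_op \<Rightarrow> seq_op \<Rightarrow> seq_op" is "\<lambda>f g x i. f x i + g x i"
  by (auto simp: algebra_simps)
lift_definition uminus_seq_op :: "seq_op \<Rightarrow> seq_op" is "\<lambda>f x i. - f x i" by auto
lift_definition minus_seq_op :: "seq_op \<Rightarrow> seq_op \<Rightarrow> seq_op" is "\<lambda>f g x i. f x i - g x i"
  by (auto simp: algebra_simps)
lift_definition times_seq_op :: "seq_op \<Rightarrow> seq_op \<Rightarrow> seq_op" is "\<lambda>f g x. f (g x)" by simp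

instance
proof
  show "(0::seq_op) \<noteq> 1"
    by transfer (metis zero_neq_one)
  show "f * (g + h) = f * g + f * h" for f g h :: seq_op
    by transfer simp
qed (transfer; simp add: fun_eq_iff algebra_simps)+

end

lift_definition scalar_op :: "complex \<Rightarrow> seq_op" is "\<lambda>c x i. c * x i"
  by (auto simp: algebra_simps)

lemma scalar_op_central: "scalar_op c * f = f * scalar_op c"
  by transfer simp

lemma scalar_op_simps [simp]:
  "scalar_op 0 = 0" "scalar_op 1 = 1"
  by (transfer; simp)+

lemma scalar_op_add: "scalar_op (c + d) = scalar_op c + scalar_op d"
  by transfer (auto simp: algebra_simps)

lemma scalar_op_diff: "scalar_op (c - d) = scalar_op c - scalar_op d"
  by transfer (auto simp: algebra_simps)

lemma scalar_op_uminus: "scalar_op (- c) = - scalar_op c"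
  by transfer auto

lemma scalar_op_mult: "scalar_op (c * d) = scalar_op c * scalar_op d"
  by transfer (auto simp: algebra_simps)

lemma scalar_op_power: "scalar_op (c ^ k) = scalar_op c ^ k"
  by (induction k) (simp_all add: scalar_op_mult)

lemma op_apply_sum: "op_apply (\<Sum>l\<in>A. f l) x i = (\<Sum>l\<in>A. op_apply (f l) x i)"
  by (induction A rule: infinite_finite_induct)
    (simp_all add: zero_seq_op.rep_eq plus_seq_op.rep_eq)

text \<open>\<open>p div q\<close> selects the segment and \<open>p mod q\<close> the position in
  it. Acting on all segments, not just the first, makes the identity block the unit 1 of the ring
  rather than a projection.\<close>

lift_definition block_op :: "nat \<Rightarrow> complex mat \<Rightarrow> nat \<Rightarrow> nat \<Rightarrow> seq_op" is
  "\<lambda>q A i j x p. \<Sum>c<q. A $$ (i * q + p mod q, j * q + c) * x (p div q * q + c)"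
  by (auto simp: sum.distrib sum_distrib_left algebra_simps)

lemma block_index_less: "i < m \<Longrightarrow> r < q \<Longrightarrow> i * q + r < m * (q::nat)"
proof -
  assume "i < m" "r < q"
  then have "i * q + r < Suc i * q" by simp
  also have "\<dots> \<le> m * q" using \<open>i < m\<close> by (intro mult_le_mono1) simp
  finally show ?thesis .
qed

lemma sum_blocks:
  fixes f :: "nat \<Rightarrow> 'a::comm_monoid_add"
  shows "(\<Sum>l<m. \<Sum>c<q. f (l * q + c)) = (\<Sum>i<m * q. f i)"
proof -
  have "(\<Sum>c<q. f (l * q + c)) = sum f {l * q..<l * q + q}" for l
    using sum.shift_bounds_nat_ivl[of f 0 "l * q" q] by (simp add: lessThan_atLeast0 add.commute)
  then show ?thesis by (simp add: sum.nat_group)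
qed

context
  fixes q :: nat
  assumes q: "0 < q"
begin

lemma block_op_mult:
  assumes A: "A \<in> carrier_mat (m * q) (p * q)" and B: "B \<in> carrier_mat (p * q) (r * q)"
    and i: "i < m" and j: "j < r"
  shows "block_op q (A * B) i j = (\<Sum>l<p. block_op q A i l * block_op q B l j)"
proof -
  have "op_apply (block_op q (A * B) i j) x t =
      op_apply (\<Sum>l<p. block_op q A i l * block_op q B l j) x t" for x t
  proof -
    let ?r = "i * q + t mod q" and ?x = "\<lambda>d. x (t div q * q + d)"
    have r: "?r < m * q" using q i by (intro block_index_less) auto
    have c: "j * q + d < r * q" if "d < q" for d using that j by (intro block_index_less)
    have "op_apply (block_op q (A * B) i j) x t = (\<Sum>d<q. (A * B) $$ (?r, j * q + d) * ?x d)"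
      by (simp add: block_op.rep_eq)
    also have "\<dots> = (\<Sum>d<q. (\<Sum>k<p * q. A $$ (?r, k) * B $$ (k, j * q + d)) * ?x d)"
      using A B r c by (intro sum.cong) (auto simp: scalar_prod_def lessThan_atLeast0)
    also have "\<dots> = (\<Sum>k<p * q. \<Sum>d<q. A $$ (?r, k) * B $$ (k, j * q + d) * ?x d)"
      by (simp only: sum_distrib_right) (rule sum.swap)
    also have "\<dots> = (\<Sum>l<p. \<Sum>e<q. \<Sum>d<q. A $$ (?r, l * q + e) * B $$ (l * q + e, j * q + d) * ?x d)"
      by (rule sum_blocks[symmetric])
    also have "\<dots> = op_apply (\<Sum>l<p. block_op q A i l * block_op q B l j) x t"
      unfolding op_apply_sum times_seq_op.rep_eq block_op.rep_eq
      using q by (intro sum.cong refl) (simp add: sum_distrib_left mult.assoc)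
    finally show ?thesis .
  qed
  then show ?thesis by (rule seq_op_eqI)
qed

lemma block_op_eqI:
  assumes A: "A \<in> carrier_mat (m * q) (p * q)" and B: "B \<in> carrier_mat (m * q) (p * q)"
    and eq: "\<And>i j. i < m \<Longrightarrow> j < p \<Longrightarrow> block_op q A i j = block_op q B i j"
  shows "A = B"
proof (rule eq_matI)
  fix u v assume "u < dim_row B" "v < dim_col B"
  then have u: "u < m * q" and v: "v < p * q" using B by auto
  \<comment> \<open>A block determines its entries: the unit sequence at \<open>v mod q\<close> lies
    in the first segment, and position \<open>u mod q\<close> of the image is the required
    entry.\<close>
  have entry: "op_apply (block_op q C (u div q) (v div q)) (\<lambda>k. if k = v mod q then 1 else 0) (u mod q)
      = C $$ (u, v)" for C
    using q by (simp add: block_op.rep_eq if_distrib cong: if_cong)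
  have "u div q < m" "v div q < p"
    using u v by (simp_all add: less_mult_imp_div_less)
  then show "A $$ (u, v) = B $$ (u, v)"
    using eq entry[of A] entry[of B] by metis
qed (use A B in auto)

lemma block_op_cong:
  assumes "\<And>r c. r < q \<Longrightarrow> c < q \<Longrightarrow> A $$ (i * q + r, j * q + c) = B $$ (k * q + r, l * q + c)"
  shows "block_op q A i j = block_op q B k l"
proof -
  have "op_apply (block_op q A i j) x p = op_apply (block_op q B k l) x p" for x p
    unfolding block_op.rep_eq using q by (intro sum.cong refl) (simp add: assms)
  then show ?thesis by (rule seq_op_eqI)
qed

lemma block_op_one:
  assumes "i < m" "j < m"
  shows "block_op q (1\<^sub>m (m * q)) i j = (if i = j then 1 else 0)"
proof -
  have "op_apply (block_op q (1\<^sub>m (m * q)) i j) x p = op_apply (if i = j then 1 else 0) x p" for x p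
  proof -
    have "(1\<^sub>m (m * q) :: complex mat) $$ (i * q + p mod q, j * q + c) =
        (if i = j \<and> c = p mod q then 1 else 0)" if "c < q" for c
    proof -
      have "i * q + p mod q = j * q + c \<longleftrightarrow> i = j \<and> c = p mod q"
      proof
        assume eq: "i * q + p mod q = j * q + c"
        show "i = j \<and> c = p mod q"
          using arg_cong[OF eq, of "\<lambda>k. k div q"] arg_cong[OF eq, of "\<lambda>k. k mod q"] that q by simp
      qed simp
      then show ?thesis
        using that assms block_index_less[of i m "p mod q" q] block_index_less[of j m c q] q by simp
    qed
    then have "op_apply (block_op q (1\<^sub>m (m * q)) i j) x p =
        (\<Sum>c<q. (if i = j \<and> c = p mod q then 1 else 0) * x (p div q * q + c))"
      by (simp add: block_op.rep_eq)
    also have "\<dots> = op_apply (if i = j then 1 else 0) x p"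
      using q by (cases "i = j")
        (simp_all add: one_seq_op.rep_eq zero_seq_op.rep_eq if_distrib[of "\<lambda>u. u * _"] cong: if_cong)
    finally show ?thesis .
  qed
  then show ?thesis by (rule seq_op_eqI)
qed

lemma block_op_zero:
  assumes "i < m" "j < p"
  shows "block_op q (0\<^sub>m (m * q) (p * q)) i j = 0"
proof -
  have "op_apply (block_op q (0\<^sub>m (m * q) (p * q)) i j) x t = op_apply 0 x t" for x t
    unfolding block_op.rep_eq zero_seq_op.rep_eq
    using assms q by (intro sum.neutral) (simp add: block_index_less)
  then show ?thesis by (rule seq_op_eqI)
qed

lemma block_op_add:
  assumes A: "A \<in> carrier_mat (m * q) (p * q)" and B: "B \<in> carrier_mat (m * q) (p * q)"
    and "i < m" "j < p"
  shows "block_op q (A + B) i j = block_op q A i j + block_op q B i j"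
proof -
  have "op_apply (block_op q (A + B) i j) x t = op_apply (block_op q A i j + block_op q B i j) x t" for x t
    unfolding block_op.rep_eq plus_seq_op.rep_eq sum.distrib[symmetric]
    using assms q by (intro sum.cong refl) (simp add: block_index_less distrib_right)
  then show ?thesis by (rule seq_op_eqI)
qed

lemma block_op_diff:
  assumes A: "A \<in> carrier_mat (m * q) (p * q)" and B: "B \<in> carrier_mat (m * q) (p * q)"
    and "i < m" "j < p"
  shows "block_op q (A - B) i j = block_op q A i j - block_op q B i j"
proof -
  have "op_apply (block_op q (A - B) i j) x t = op_apply (block_op q A i j - block_op q B i j) x t" for x t
    unfolding block_op.rep_eq minus_seq_op.rep_eq sum_subtractf[symmetric]
    using assms q by (intro sum.cong refl) (simp add: block_index_less left_diff_distrib)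
  then show ?thesis by (rule seq_op_eqI)
qed

lemma block_op_uminus:
  assumes A: "A \<in> carrier_mat (m * q) (p * q)" and "i < m" "j < p"
  shows "block_op q (- A) i j = - block_op q A i j"
proof -
  have "op_apply (block_op q (- A) i j) x t = op_apply (- block_op q A i j) x t" for x t
    unfolding block_op.rep_eq uminus_seq_op.rep_eq sum_negf[symmetric]
    using assms q by (intro sum.cong refl) (simp add: block_index_less)
  then show ?thesis by (rule seq_op_eqI)
qed

lemma block_op_smult:
  assumes A: "A \<in> carrier_mat (m * q) (p * q)" and "i < m" "j < p"
  shows "block_op q (c \<cdot>\<^sub>m A) i j = scalar_op c * block_op q A i j"
proof -
  have "op_apply (block_op q (c \<cdot>\<^sub>m A) i j) x t = op_apply (scalar_op c * block_op q A i j) x t" for x t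
    unfolding block_op.rep_eq times_seq_op.rep_eq scalar_op.rep_eq sum_distrib_left
    using assms q by (intro sum.cong refl) (simp add: block_index_less)
  then show ?thesis by (rule seq_op_eqI)
qed

lemma block_op_blk_col:
  assumes "i < m"
  shows "block_op q (blk_col q m f) i 0 = block_op q (f i) 0 0"
  using assms by (intro block_op_cong) (simp add: blk_col_def block_index_less)

lemma block_op_blk_hankel:
  assumes "i \<le> k" "j \<le> k"
  shows "block_op q (blk_hankel q f k) i j = block_op q (f (i + j)) 0 0"
  using assms block_index_less[of i "Suc k" _ q] block_index_less[of j "Suc k" _ q]
  by (intro block_op_cong) (simp add: blk_hankel_def)

lemma block_op_blk_row_I:
  assumes X: "X \<in> carrier_mat q (k * q)" and j: "j \<le> k"
  shows "block_op q (blk_row_I q X) 0 j = (if j = k then 1 else block_op q X 0 j)"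
proof (cases "j = k")
  case True
  have "block_op q (blk_row_I q X) 0 k = block_op q (1\<^sub>m (1 * q)) 0 0"
    using X by (intro block_op_cong) (auto simp: blk_row_I_def)
  then show ?thesis using True block_op_one[of 0 1 0] by simp
next
  case False
  then have "j * q + c < k * q" if "c < q" for c using that j by (intro block_index_less) auto
  then show ?thesis using X False
    by (simp, intro block_op_cong) (auto simp: blk_row_I_def trans_less_add1)
qed

lemma block_op_four_block_mat:
  assumes "A \<in> carrier_mat q q" "B \<in> carrier_mat q q" "C \<in> carrier_mat q q" "D \<in> carrier_mat q q"
  shows "block_op q (four_block_mat A B C D) 0 0 = block_op q A 0 0"
    "block_op q (four_block_mat A B C D) 0 (Suc 0) = block_op q B 0 0"
    "block_op q (four_block_mat A B C D) (Suc 0) 0 = block_op q C 0 0"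
    "block_op q (four_block_mat A B C D) (Suc 0) (Suc 0) = block_op q D 0 0"
  by (rule block_op_cong; use assms in \<open>auto simp: four_block_mat_def Let_def\<close>)+

end

section \<open>Adjoints, inverses and positive definite matrices\<close>

lemma mat_adjoint_carrier [simp]: "A \<in> carrier_mat m p \<Longrightarrow> mat_adjoint A \<in> carrier_mat p m"
  by (auto simp: mat_adjoint_def)

lemma mat_adjoint_dim [simp]:
  "dim_row (mat_adjoint A) = dim_col A" "dim_col (mat_adjoint A) = dim_row A"
  by (auto simp: mat_adjoint_def)

lemma mat_adjoint_index [simp]:
  "i < dim_col A \<Longrightarrow> j < dim_row A \<Longrightarrow> mat_adjoint A $$ (i, j) = conjugate (A $$ (j, i))"
  by (simp add: mat_adjoint_def mat_of_rows_index)

lemma mat_adjoint_mult: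
  fixes A B :: "complex mat"
  assumes "A \<in> carrier_mat m p" "B \<in> carrier_mat p r"
  shows "mat_adjoint (A * B) = mat_adjoint B * mat_adjoint A"
  using assms by (intro eq_matI) (auto simp: scalar_prod_def mult.commute intro!: sum.cong)

lemma mat_adjoint_adjoint [simp]: "mat_adjoint (mat_adjoint A) = (A :: complex mat)"
  by (intro eq_matI) auto

lemma mat_adjoint_add:
  fixes A B :: "complex mat"
  assumes "A \<in> carrier_mat m p" "B \<in> carrier_mat m p"
  shows "mat_adjoint (A + B) = mat_adjoint A + mat_adjoint B"
  using assms by (intro eq_matI) auto

lemma mat_adjoint_diff:
  fixes A B :: "complex mat"
  assumes "A \<in> carrier_mat m p" "B \<in> carrier_mat m p"
  shows "mat_adjoint (A - B) = mat_adjoint A - mat_adjoint B"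
  using assms by (intro eq_matI) auto

lemma mat_adjoint_uminus: "mat_adjoint (- A) = - mat_adjoint (A :: complex mat)"
  by (intro eq_matI) auto

lemma mat_adjoint_smult: "mat_adjoint (c \<cdot>\<^sub>m A) = cnj c \<cdot>\<^sub>m mat_adjoint (A :: complex mat)"
  by (intro eq_matI) auto

lemma mat_adjoint_one [simp]: "mat_adjoint (1\<^sub>m k :: complex mat) = 1\<^sub>m k"
  by (intro eq_matI) auto

lemma mat_adjoint_zero [simp]: "mat_adjoint (0\<^sub>m k l :: complex mat) = 0\<^sub>m l k"
  by (intro eq_matI) auto

lemma mat_adjoint_four_block_mat:
  fixes A B C D :: "complex mat"
  assumes "A \<in> carrier_mat k k" "B \<in> carrier_mat k k" "C \<in> carrier_mat k k" "D \<in> carrier_mat k k"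
  shows "mat_adjoint (four_block_mat A B C D) =
    four_block_mat (mat_adjoint A) (mat_adjoint C) (mat_adjoint B) (mat_adjoint D)"
  using assms by (intro eq_matI) auto

lemma hermitian_mat_diff:
  assumes "A \<in> carrier_mat k k" "B \<in> carrier_mat k k" "hermitian_mat A" "hermitian_mat B"
  shows "hermitian_mat (A - B)"
  using assms by (auto simp: hermitian_mat_def mat_adjoint_diff)

lemma hermitian_mat_add:
  assumes "A \<in> carrier_mat k k" "B \<in> carrier_mat k k" "hermitian_mat A" "hermitian_mat B"
  shows "hermitian_mat (A + B)"
  using assms by (auto simp: hermitian_mat_def mat_adjoint_add)

lemma hermitian_mat_uminus: "hermitian_mat A \<Longrightarrow> hermitian_mat (- A)"
  by (auto simp: hermitian_mat_def mat_adjoint_uminus)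

lemma hermitian_mat_smult: "hermitian_mat A \<Longrightarrow> hermitian_mat (complex_of_real r \<cdot>\<^sub>m A)"
  by (auto simp: hermitian_mat_def mat_adjoint_smult)

text \<open>For square matrices a right inverse is two-sided and gives the choice in
  \<open>minv\<close> a witness, so below only right inverses have to be produced.\<close>

lemma minv_inverse:
  assumes A: "A \<in> carrier_mat k k"
    and ex: "\<exists>B \<in> carrier_mat k k. A * B = 1\<^sub>m k"
  shows "minv A \<in> carrier_mat k k" "A * minv A = 1\<^sub>m k" "minv A * A = 1\<^sub>m k"
proof -
  have dim: "dim_row A = k" using A by auto
  obtain B where "B \<in> carrier_mat k k \<and> A * B = 1\<^sub>m k \<and> B * A = 1\<^sub>m k"
    using ex mat_mult_left_right_inverse[OF A] by blast
  then have "minv A \<in> carrier_mat k k \<and> A * minv A = 1\<^sub>m k \<and> minv A * A = 1\<^sub>m k"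
    unfolding minv_def dim by (rule someI)
  then show "minv A \<in> carrier_mat k k" "A * minv A = 1\<^sub>m k" "minv A * A = 1\<^sub>m k" by blast+
qed

lemma minv_unique:
  assumes A: "A \<in> carrier_mat k k" and B: "B \<in> carrier_mat k k" and AB: "A * B = 1\<^sub>m k"
  shows "minv A = B"
proof -
  note inv = minv_inverse[OF A bexI[of "\<lambda>B. A * B = 1\<^sub>m k", OF AB B]]
  have "minv A = minv A * (A * B)" using inv AB by simp
  also have "\<dots> = B" using inv A B by (simp add: assoc_mult_mat[symmetric, of _ k k _ k _ k])
  finally show ?thesis .
qed

lemma minv_adjoint:
  assumes A: "A \<in> carrier_mat k k" and ex: "\<exists>B \<in> carrier_mat k k. A * B = 1\<^sub>m k"
  shows "minv (mat_adjoint A) = mat_adjoint (minv A)"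
proof (rule minv_unique)
  note inv = minv_inverse[OF A ex]
  show "mat_adjoint A * mat_adjoint (minv A) = 1\<^sub>m k"
    using mat_adjoint_mult[OF inv(1) A] inv(3) by simp
  show "mat_adjoint (minv A) \<in> carrier_mat k k" using inv(1) by simp
qed (use A in simp)

lemma hermitian_mat_minv:
  assumes A: "A \<in> carrier_mat k k" and ex: "\<exists>B \<in> carrier_mat k k. A * B = 1\<^sub>m k"
    and herm: "hermitian_mat A"
  shows "hermitian_mat (minv A)"
  using minv_adjoint[OF A ex] herm minv_inverse(1)[OF A ex]
  by (auto simp: hermitian_mat_def)

lemma det_nonzero_right_inverse:
  fixes A :: "complex mat"
  assumes A: "A \<in> carrier_mat k k" and "det A \<noteq> 0"
  shows "\<exists>B \<in> carrier_mat k k. A * B = 1\<^sub>m k"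
  using det_non_zero_imp_unit[OF A assms(2), of "()"] by (auto simp: Units_def ring_mat_def)

lemma posdef_mat_right_inverse:
  assumes A: "A \<in> carrier_mat k k" and pd: "posdef_mat A"
  shows "\<exists>B \<in> carrier_mat k k. A * B = 1\<^sub>m k"
proof (rule det_nonzero_right_inverse[OF A], rule notI)
  assume "det A = 0"
  then obtain v where v: "v \<in> carrier_vec k" "v \<noteq> 0\<^sub>v k" "A *\<^sub>v v = 0\<^sub>v k"
    using det_0_iff_vec_prod_zero_field[OF A] by blast
  moreover have "dim_row A = k" using A by auto
  ultimately have "0 < conjugate v \<bullet> (0\<^sub>v k :: complex vec)"
    using pd unfolding posdef_mat_def by metis
  then show False using v(1) by simp
qed

lemma posdef_mat_leading_submatrix:
  fixes A B :: "complex mat"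
  assumes A: "A \<in> carrier_mat N N" and B: "B \<in> carrier_mat M M" and "M \<le> N"
    and entries: "\<And>i j. i < M \<Longrightarrow> j < M \<Longrightarrow> B $$ (i, j) = A $$ (i, j)"
    and pd: "posdef_mat A"
  shows "posdef_mat B"
  unfolding posdef_mat_def
proof (intro conjI ballI impI)
  have herm: "cnj (A $$ (j, i)) = A $$ (i, j)" if "i < N" "j < N" for i j
    using pd that A mat_adjoint_index[of i A j] by (auto simp: posdef_mat_def hermitian_mat_def)
  show "hermitian_mat B"
    using B \<open>M \<le> N\<close> by (auto simp: hermitian_mat_def entries herm intro!: eq_matI)
next
  fix v :: "complex vec"
  assume v: "v \<in> carrier_vec (dim_row B)" "v \<noteq> 0\<^sub>v (dim_row B)"
  have v': "v \<in> carrier_vec M" using v B by auto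
  define w where "w = vec N (\<lambda>i. if i < M then v $ i else 0)"
  have w: "w \<in> carrier_vec N" by (simp add: w_def)
  obtain i where "i < M" "v $ i \<noteq> 0" using v v' B by (auto simp: vec_eq_iff)
  then have "w $ i \<noteq> 0" "i < N" using \<open>M \<le> N\<close> by (auto simp: w_def)
  then have "w \<noteq> 0\<^sub>v N" by auto
  then have pos: "0 < conjugate w \<bullet> (A *\<^sub>v w)"
    using pd w A by (auto simp: posdef_mat_def)
  have cut: "(\<Sum>j<N. g j (w $ j)) = (\<Sum>j<M. g j (v $ j))"
    if "\<And>j. g j 0 = 0" for g :: "nat \<Rightarrow> complex \<Rightarrow> complex"
  proof -
    have "(\<Sum>j<N. g j (w $ j)) = (\<Sum>j<M. g j (w $ j))"
      using \<open>M \<le> N\<close> that by (intro sum.mono_neutral_right) (auto simp: w_def)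
    also have "\<dots> = (\<Sum>j<M. g j (v $ j))"
      using \<open>M \<le> N\<close> by (intro sum.cong) (auto simp: w_def)
    finally show ?thesis .
  qed
  have "conjugate w \<bullet> (A *\<^sub>v w) = (\<Sum>i<N. cnj (w $ i) * (\<Sum>j<N. A $$ (i, j) * w $ j))"
    using A w by (auto simp: scalar_prod_def lessThan_atLeast0 intro!: sum.cong)
  also have "\<dots> = (\<Sum>i<M. cnj (v $ i) * (\<Sum>j<M. A $$ (i, j) * v $ j))"
    using cut[of "\<lambda>i x. cnj x * (\<Sum>j<N. A $$ (i, j) * w $ j)"]
    by (simp add: cut[of "\<lambda>j x. A $$ (_, j) * x"])
  also have "\<dots> = (\<Sum>i<M. cnj (v $ i) * (\<Sum>j<M. B $$ (i, j) * v $ j))"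
    by (simp add: entries)
  also have "\<dots> = conjugate v \<bullet> (B *\<^sub>v v)"
    using B v' by (auto simp: scalar_prod_def lessThan_atLeast0 intro!: sum.cong)
  finally show "0 < conjugate v \<bullet> (B *\<^sub>v v)" using pos by simp
qed

lemma blk_hankel_carrier [simp]: "blk_hankel q f k \<in> carrier_mat (Suc k * q) (Suc k * q)"
  by (simp add: blk_hankel_def)

lemma blk_col_carrier [simp]: "blk_col q m f \<in> carrier_mat (m * q) q"
  by (simp add: blk_col_def)

lemma posdef_blk_hankel_mono:
  assumes "posdef_mat (blk_hankel q f k)" "j \<le> k"
  shows "posdef_mat (blk_hankel q f j)"
proof (rule posdef_mat_leading_submatrix[OF blk_hankel_carrier blk_hankel_carrier _ _ assms(1)])
  show le: "Suc j * q \<le> Suc k * q" using assms(2) by (intro mult_le_mono1) simp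
  show "blk_hankel q f j $$ (i, l) = blk_hankel q f k $$ (i, l)"
    if "i < Suc j * q" "l < Suc j * q" for i l
    unfolding blk_hankel_def
    using that order.strict_trans2[OF that(1) le] order.strict_trans2[OF that(2) le]
    by (simp del: mult_Suc)
qed

lemma Tmat_carrier [simp]: "Tmat q j \<in> carrier_mat (Suc j * q) (Suc j * q)"
  by (simp add: Tmat_def)

lemma Tmat_dim: "dim_row (Tmat q j) = Suc j * q" "dim_col (Tmat q j) = Suc j * q"
  by (simp_all add: Tmat_def)

text \<open>1 - zT is lower triangular with unit diagonal, hence of determinant 1 for every
  \<open>z\<close>.\<close>

lemma Rmat_inverse:
  assumes "0 < q"
  shows "Rmat q j z \<in> carrier_mat (Suc j * q) (Suc j * q)"
    "(1\<^sub>m (Suc j * q) - z \<cdot>\<^sub>m Tmat q j) * Rmat q j z = 1\<^sub>m (Suc j * q)"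
    "Rmat q j z * (1\<^sub>m (Suc j * q) - z \<cdot>\<^sub>m Tmat q j) = 1\<^sub>m (Suc j * q)"
proof -
  let ?N = "Suc j * q" and ?A = "1\<^sub>m (Suc j * q) - z \<cdot>\<^sub>m Tmat q j"
  have A: "?A \<in> carrier_mat ?N ?N"
    by (intro minus_carrier_mat smult_carrier_mat Tmat_carrier)
  have T: "Tmat q j $$ (r, c) = 0" if "r \<le> c" "c < ?N" for r c
    using that div_le_mono[OF that(1), of q] by (auto simp: Tmat_def simp del: mult_Suc)
  have entry: "?A $$ (r, c) = (if r = c then 1 else 0)" if "r \<le> c" "c < ?N" for r c
    using that T[OF that] order.strict_trans1[OF that]
    by (simp add: Tmat_dim del: mult_Suc)
  have "det ?A = prod_list (diag_mat ?A)"
    by (rule det_lower_triangular[OF _ A]) (simp add: entry del: mult_Suc)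
  also have "diag_mat ?A = map (\<lambda>i. 1) [0..<?N]"
    using entry A by (simp add: diag_mat_def Tmat_dim del: mult_Suc)
  finally have "det ?A \<noteq> 0" by (auto simp: prod_list_zero_iff)
  note inv = minv_inverse[OF A det_nonzero_right_inverse[OF A this]]
  show "Rmat q j z \<in> carrier_mat ?N ?N" "?A * Rmat q j z = 1\<^sub>m ?N" "Rmat q j z * ?A = 1\<^sub>m ?N"
    using inv by (simp_all add: Rmat_def)
qed

section \<open>Block Hankel matrices and orthogonal rows\<close>

abbreviation mat_op :: "nat \<Rightarrow> complex mat \<Rightarrow> seq_op" where
  "mat_op q A \<equiv> block_op q A 0 0"

context
  fixes q :: nat
  assumes q: "0 < q"
begin

lemma mat_op_add: "A \<in> carrier_mat q q \<Longrightarrow> B \<in> carrier_mat q q \<Longrightarrow>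
    mat_op q (A + B) = mat_op q A + mat_op q B"
  using block_op_add[OF q, of A 1 1 B 0 0] by simp

lemma mat_op_diff: "A \<in> carrier_mat q q \<Longrightarrow> B \<in> carrier_mat q q \<Longrightarrow>
    mat_op q (A - B) = mat_op q A - mat_op q B"
  using block_op_diff[OF q, of A 1 1 B 0 0] by simp

lemma mat_op_uminus: "A \<in> carrier_mat q q \<Longrightarrow> mat_op q (- A) = - mat_op q A"
  using block_op_uminus[OF q, of A 1 1 0 0] by simp

lemma mat_op_smult: "A \<in> carrier_mat q q \<Longrightarrow> mat_op q (c \<cdot>\<^sub>m A) = scalar_op c * mat_op q A"
  using block_op_smult[OF q, of A 1 1 0 0] by simp

lemma mat_op_mult: "A \<in> carrier_mat q q \<Longrightarrow> B \<in> carrier_mat q q \<Longrightarrow>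
    mat_op q (A * B) = mat_op q A * mat_op q B"
  using block_op_mult[OF q, of A 1 1 B 1 0 0] by simp

lemma block_op_mult_col:
  assumes "A \<in> carrier_mat (m * q) (p * q)" "B \<in> carrier_mat (p * q) q" "i < m"
  shows "block_op q (A * B) i 0 = (\<Sum>l<p. block_op q A i l * block_op q B l 0)"
  by (rule block_op_mult[OF q assms(1), of B 1 i 0]) (use assms in simp_all)

lemma block_op_mult_row:
  assumes "A \<in> carrier_mat q (p * q)" "B \<in> carrier_mat (p * q) (r * q)" "j < r"
  shows "block_op q (A * B) 0 j = (\<Sum>l<p. block_op q A 0 l * block_op q B l j)"
  by (rule block_op_mult[OF q, of A 1 p B r 0 j]) (use assms in simp_all)

lemma block_op_mult_row_col:
  assumes "A \<in> carrier_mat q (p * q)" "B \<in> carrier_mat (p * q) q"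
  shows "mat_op q (A * B) = (\<Sum>l<p. block_op q A 0 l * block_op q B l 0)"
  by (rule block_op_mult[OF q, of A 1 p B 1 0 0]) (use assms in simp_all)

lemma blk_row_I_carrier:
  "X \<in> carrier_mat q (k * q) \<Longrightarrow> blk_row_I q X \<in> carrier_mat q (Suc k * q)"
  by (auto simp: blk_row_I_def)

lemma mat_op_one: "mat_op q (1\<^sub>m q) = 1"
  using block_op_one[OF q, of 0 1 0] by simp

lemma mat_op_zero: "mat_op q (0\<^sub>m q q) = 0"
  using block_op_zero[OF q, of 0 1 0 1] by simp

lemma mat_op_inject:
  "A \<in> carrier_mat q q \<Longrightarrow> B \<in> carrier_mat q q \<Longrightarrow> mat_op q A = mat_op q B \<Longrightarrow> A = B"
  using block_op_eqI[OF q, of A 1 1 B] by simp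

text \<open>\<open>X\<close> need not come from a matrix, so it cannot be used as the inverse
  directly. If \<open>A\<close> were singular, a matrix \<open>U\<close> whose rows all equal a
  nonzero left null vector would satisfy U A = 0, hence U = U A X = 0.\<close>

lemma mat_op_right_inverse:
  assumes A: "A \<in> carrier_mat q q" and AX: "mat_op q A * X = 1"
  shows "\<exists>B \<in> carrier_mat q q. A * B = 1\<^sub>m q"
proof (rule det_nonzero_right_inverse[OF A], rule notI)
  assume "det A = 0"
  then have "det (transpose_mat A) = 0" using det_transpose[OF A] by simp
  then obtain v where v: "v \<in> carrier_vec q" "v \<noteq> 0\<^sub>v q" "transpose_mat A *\<^sub>v v = 0\<^sub>v q"
    using det_0_iff_vec_prod_zero_field[of "transpose_mat A" q] A by auto
  define U where "U = mat q q (\<lambda>(i, j). v $ j)"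
  have U: "U \<in> carrier_mat q q" by (simp add: U_def)
  have "U * A = 0\<^sub>m q q"
  proof (rule eq_matI)
    fix i j assume ij: "i < dim_row (0\<^sub>m q q :: complex mat)" "j < dim_col (0\<^sub>m q q :: complex mat)"
    then have "(transpose_mat A *\<^sub>v v) $ j = 0" using v(3) by simp
    then show "(U * A) $$ (i, j) = 0\<^sub>m q q $$ (i, j)"
      using ij A v(1) by (simp add: U_def scalar_prod_def mult.commute)
  qed (use A U in auto)
  then have "mat_op q U * mat_op q A = 0"
    using mat_op_mult[OF U A] by (simp add: mat_op_zero)
  then have "mat_op q U = mat_op q (0\<^sub>m q q)"
    using AX by (metis mult.assoc mult.right_neutral mult_zero_left mat_op_zero)
  then have "U = 0\<^sub>m q q" by (rule mat_op_inject[OF U zero_carrier_mat])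
  moreover obtain j where j: "j < q" "v $ j \<noteq> 0" using v by (auto simp: vec_eq_iff)
  ultimately have "U $$ (j, j) = 0" by simp
  then show False using j by (simp add: U_def)
qed

lemma block_op_Tmat:
  assumes "i \<le> j" "l \<le> j"
  shows "block_op q (Tmat q j) i l = (if i = Suc l then 1 else 0)"
proof -
  have entry: "Tmat q j $$ (i * q + r, l * q + c) = (if i = Suc l \<and> r = c then 1 else 0)"
    if "r < q" "c < q" for r c
    using that assms block_index_less[of i "Suc j" r q] block_index_less[of l "Suc j" c q]
    by (simp add: Tmat_def del: mult_Suc)
  show ?thesis
  proof (cases "i = Suc l")
    case True
    have "block_op q (Tmat q j) i l = mat_op q (1\<^sub>m q)"
      using entry True by (intro block_op_cong[OF q]) simp
    then show ?thesis using True by (simp add: mat_op_one)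
  next
    case False
    have "block_op q (Tmat q j) i l = mat_op q (0\<^sub>m q q)"
      using entry False by (intro block_op_cong[OF q]) simp
    then show ?thesis using False by (simp add: mat_op_zero)
  qed
qed

lemma Rmat_mult_carrier:
  "C \<in> carrier_mat (Suc j * q) p \<Longrightarrow> Rmat q j z * C \<in> carrier_mat (Suc j * q) p"
  by (rule mult_carrier_mat[OF Rmat_inverse(1)[OF q]])

text \<open>Reading (1 - zT)(RC) = C block row by block row gives a Horner recursion, which replaces
  any closed formula for the resolvent of T.\<close>

lemma block_op_Rmat_mult:
  assumes C: "C \<in> carrier_mat (Suc j * q) q"
  shows "block_op q (Rmat q j z * C) 0 0 = block_op q C 0 0"
    and "i < j \<Longrightarrow> block_op q (Rmat q j z * C) (Suc i) 0 =
      block_op q C (Suc i) 0 + scalar_op z * block_op q (Rmat q j z * C) i 0"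
proof -
  let ?N = "Suc j * q" and ?X = "Rmat q j z * C"
  let ?A = "1\<^sub>m (Suc j * q) - z \<cdot>\<^sub>m Tmat q j"
  have A: "?A \<in> carrier_mat ?N ?N"
    by (intro minus_carrier_mat smult_carrier_mat Tmat_carrier)
  have X: "?X \<in> carrier_mat ?N q" by (rule Rmat_mult_carrier[OF C])
  have "?A * ?X = C"
    using assoc_mult_mat[OF A Rmat_inverse(1)[OF q, of j z] C] Rmat_inverse(2)[OF q, of j z] C
    by simp
  then have C_eq: "block_op q C i 0 = (\<Sum>l<Suc j. block_op q ?A i l * block_op q ?X l 0)"
    if "i \<le> j" for i
    using block_op_mult_col[OF A X, of i] that \<open>?A * ?X = C\<close> by simp
  have A_eq: "block_op q ?A i l = (if i = l then 1 else 0) - (if i = Suc l then scalar_op z else 0)"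
    if "i \<le> j" "l \<le> j" for i l
    using that block_op_diff[OF q one_carrier_mat smult_carrier_mat[OF Tmat_carrier], of i j l]
    by (simp add: block_op_one[OF q] block_op_smult[OF q Tmat_carrier] block_op_Tmat del: mult_Suc)
  have "block_op q C i 0 = (\<Sum>l<Suc j. (if i = l then block_op q ?X l 0 else 0)
      - (if i = Suc l then scalar_op z * block_op q ?X l 0 else 0))" if "i \<le> j" for i
    unfolding C_eq[OF that] using that by (intro sum.cong) (auto simp: A_eq left_diff_distrib simp del: mult_Suc)
  then have sums: "block_op q C i 0 = block_op q ?X i 0
      - (\<Sum>l<Suc j. if i = Suc l then scalar_op z * block_op q ?X l 0 else 0)" if "i \<le> j" for i
    using that by (simp only: sum_subtractf) (simp del: sum.lessThan_Suc)
  show "block_op q ?X 0 0 = block_op q C 0 0" using sums[of 0] by simp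
  show "block_op q ?X (Suc i) 0 = block_op q C (Suc i) 0 + scalar_op z * block_op q ?X i 0"
    if "i < j"
    using sums[of "Suc i"] that by (simp del: sum.lessThan_Suc)
qed

text \<open>The row r H^{-1}, that is, the solution of the Hankel system with right-hand side
  \<open>r\<close>.\<close>

definition hankel_row :: "(nat \<Rightarrow> complex mat) \<Rightarrow> nat \<Rightarrow> (nat \<Rightarrow> seq_op) \<Rightarrow> nat \<Rightarrow> seq_op" where
  "hankel_row f k r l = (\<Sum>i<Suc k. r i * block_op q (minv (blk_hankel q f k)) i l)"

lemma blk_hankel_minv:
  assumes pd: "posdef_mat (blk_hankel q f k)"
    and \<sigma>: "\<And>l. l \<le> 2 * k \<Longrightarrow> \<sigma> l = mat_op q (f l)" and ij: "i \<le> k" "j \<le> k"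
  shows "(\<Sum>l<Suc k. \<sigma> (i + l) * block_op q (minv (blk_hankel q f k)) l j) = (if i = j then 1 else 0)"
    and "(\<Sum>l<Suc k. block_op q (minv (blk_hankel q f k)) i l * \<sigma> (l + j)) = (if i = j then 1 else 0)"
proof -
  let ?H = "blk_hankel q f k"
  note inv = minv_inverse[OF blk_hankel_carrier posdef_mat_right_inverse[OF blk_hankel_carrier pd]]
  have block: "block_op q ?H i l = \<sigma> (i + l)" if "i \<le> k" "l \<le> k" for i l
    using that by (simp add: block_op_blk_hankel[OF q] \<sigma>)
  show "(\<Sum>l<Suc k. \<sigma> (i + l) * block_op q (minv ?H) l j) = (if i = j then 1 else 0)"
    using block_op_mult[OF q blk_hankel_carrier[of q f k] inv(1), of i j] ij
    by (simp add: inv(2) block_op_one[OF q] block del: sum.lessThan_Suc mult_Suc)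
  show "(\<Sum>l<Suc k. block_op q (minv ?H) i l * \<sigma> (l + j)) = (if i = j then 1 else 0)"
    using block_op_mult[OF q inv(1) blk_hankel_carrier[of q f k], of i j] ij
    by (simp add: inv(3) block_op_one[OF q] block del: sum.lessThan_Suc mult_Suc)
qed

lemma hankel_regular_blk_hankel:
  assumes "posdef_mat (blk_hankel q f k)" "\<And>l. l \<le> 2 * k \<Longrightarrow> \<sigma> l = mat_op q (f l)"
  shows "hankel_regular \<sigma> (Suc k)"
  unfolding hankel_regular_def
  by (intro exI[of _ "block_op q (minv (blk_hankel q f k))"] allI impI blk_hankel_minv(1)[OF assms])
    simp_all

lemma row_dot_hankel_row:
  assumes "posdef_mat (blk_hankel q f k)" "\<And>l. l \<le> 2 * k \<Longrightarrow> \<sigma> l = mat_op q (f l)" and "m \<le> k"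
  shows "row_dot (Suc k) (hankel_row f k r) (\<lambda>l. \<sigma> (l + m)) = r m"
proof -
  have "row_dot (Suc k) (hankel_row f k r) (\<lambda>l. \<sigma> (l + m)) =
      (\<Sum>l<Suc k. \<Sum>i<Suc k. r i * (block_op q (minv (blk_hankel q f k)) i l * \<sigma> (l + m)))"
    unfolding row_dot_def hankel_row_def sum_distrib_right by (simp only: mult.assoc)
  also have "\<dots> = (\<Sum>i<Suc k. r i * (\<Sum>l<Suc k. block_op q (minv (blk_hankel q f k)) i l * \<sigma> (l + m)))"
    unfolding sum_distrib_left by (rule sum.swap)
  also have "\<dots> = (\<Sum>i<Suc k. r i * (if i = m then 1 else 0))"
    using blk_hankel_minv(2)[OF assms(1,2) _ assms(3)] by (intro sum.cong) auto
  also have "\<dots> = r m"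
    using assms(3) by (simp add: if_distrib del: sum.lessThan_Suc cong: if_cong)
  finally show ?thesis .
qed

lemma block_op_adjoint_blk_col:
  assumes "i < m" "f i \<in> carrier_mat q q"
  shows "block_op q (mat_adjoint (blk_col q m f)) 0 i = mat_op q (mat_adjoint (f i))"
  using assms block_index_less[of i m _ q]
  by (intro block_op_cong[OF q]) (auto simp: blk_col_def)

text \<open>Because the blocks of \<open>V\<close> are Hermitian, its adjoint is the row of the same
  blocks, and multiplying it by the inverse Hankel matrix solves a Hankel system. Applied to mu,
  lambda and Theta_2(a)^{-1} Gamma_2(a), it gives both their values and their Hermitian
  symmetry.\<close>

lemma mat_op_quadratic_form:
  assumes pd: "posdef_mat (blk_hankel q f k)"
    and g: "\<And>i. i \<le> k \<Longrightarrow> g i \<in> carrier_mat q q \<and> hermitian_mat (g i)"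
  defines "V \<equiv> blk_col q (Suc k) g"
  shows "mat_op q (mat_adjoint V * minv (blk_hankel q f k) * V) =
      row_dot (Suc k) (hankel_row f k (\<lambda>i. mat_op q (g i))) (\<lambda>l. mat_op q (g l))"
    and "hermitian_mat (mat_adjoint V * minv (blk_hankel q f k) * V)"
    and "mat_adjoint V * minv (blk_hankel q f k) * V \<in> carrier_mat q q"
proof -
  let ?N = "Suc k * q" and ?H = "minv (blk_hankel q f k)"
  note ex = posdef_mat_right_inverse[OF blk_hankel_carrier pd]
  note H = minv_inverse(1)[OF blk_hankel_carrier ex]
  have V: "V \<in> carrier_mat ?N q" and V': "mat_adjoint V \<in> carrier_mat q ?N"
    by (simp_all add: V_def del: mult_Suc)
  have V'H: "mat_adjoint V * ?H \<in> carrier_mat q ?N"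
    using V' H by (rule mult_carrier_mat)
  have adj: "block_op q (mat_adjoint V) 0 i = mat_op q (g i)" if "i \<le> k" for i
    unfolding V_def using that g[of i] block_op_adjoint_blk_col[of i "Suc k" g]
    by (auto simp: hermitian_mat_def)
  have V_blk: "block_op q V l 0 = mat_op q (g l)" if "l \<le> k" for l
    using that by (simp add: V_def block_op_blk_col[OF q])
  have row: "block_op q (mat_adjoint V * ?H) 0 l = hankel_row f k (\<lambda>i. mat_op q (g i)) l"
    if "l \<le> k" for l
    using block_op_mult_row[OF V' H, of l] that
    by (simp add: hankel_row_def adj del: sum.lessThan_Suc mult_Suc)
  show "mat_op q (mat_adjoint V * ?H * V) =
      row_dot (Suc k) (hankel_row f k (\<lambda>i. mat_op q (g i))) (\<lambda>l. mat_op q (g l))"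
    using block_op_mult_row_col[OF V'H V]
    by (simp add: row row_dot_def V_blk del: sum.lessThan_Suc mult_Suc)
  have "hermitian_mat ?H"
    using hermitian_mat_minv[OF blk_hankel_carrier ex] pd by (simp add: posdef_mat_def)
  then have "mat_adjoint (mat_adjoint V * ?H * V) = mat_adjoint V * (?H * V)"
    using mat_adjoint_mult[OF V'H V] mat_adjoint_mult[OF V' H] by (simp add: hermitian_mat_def)
  also have "\<dots> = mat_adjoint V * ?H * V"
    using assoc_mult_mat[OF V' H V] by simp
  finally show "hermitian_mat (mat_adjoint V * ?H * V)"
    using V V' by (auto simp: hermitian_mat_def)
  show "mat_adjoint V * ?H * V \<in> carrier_mat q q"
    by (rule mult_carrier_mat[OF V'H V])
qed

text \<open>The blocks of (-Y^* H^{-1}, I), the coefficients of the monic orthogonal polynomial of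
  degree \<open>k\<close>. For \<open>k = 0\<close> only \<open>l = 0\<close> is read, with value 1,
  in accordance with P_{2,0} = I.\<close>

definition orth_row :: "(nat \<Rightarrow> complex mat) \<Rightarrow> nat \<Rightarrow> nat \<Rightarrow> seq_op" where
  "orth_row f k l =
    (if l = k then 1 else - hankel_row f (k - 1) (\<lambda>i. mat_op q (f (k + i))) l)"

definition orth_mat :: "(nat \<Rightarrow> complex mat) \<Rightarrow> nat \<Rightarrow> complex mat" where
  "orth_mat f k = blk_row_I q
    (- (mat_adjoint (blk_col q k (\<lambda>i. f (k + i))) * minv (blk_hankel q f (k - 1))))"

text \<open>Against the shift by \<open>m\<close> the lower coefficients produce -\<sigma> (k + m),
  which the leading coefficient 1 cancels. The largest index met is k + (k - 1).\<close>

lemma orth_row_orthogonal: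
  assumes pd: "0 < k \<Longrightarrow> posdef_mat (blk_hankel q f (k - 1))"
    and \<sigma>: "\<And>l. l \<le> 2 * k - 1 \<Longrightarrow> \<sigma> l = mat_op q (f l)" and m: "m < k"
  shows "row_dot (Suc k) (orth_row f k) (\<lambda>l. \<sigma> (l + m)) = 0"
proof -
  obtain p where p: "k = Suc p" using m by (cases k) auto
  have "row_dot k (orth_row f k) (\<lambda>l. \<sigma> (l + m)) =
      - row_dot (Suc p) (hankel_row f p (\<lambda>i. mat_op q (f (k + i)))) (\<lambda>l. \<sigma> (l + m))"
    unfolding row_dot_def p sum_negf[symmetric] by (intro sum.cong) (simp_all add: orth_row_def)
  also have "row_dot (Suc p) (hankel_row f p (\<lambda>i. mat_op q (f (k + i)))) (\<lambda>l. \<sigma> (l + m)) = \<sigma> (k + m)"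
    using row_dot_hankel_row[of f p \<sigma> m] pd \<sigma> m p by simp
  finally show ?thesis by (simp add: row_dot_Suc orth_row_def[of f k k])
qed

lemma orth_mat_mult:
  assumes k: "0 < k" and pd: "posdef_mat (blk_hankel q f (k - 1))"
    and f: "\<And>l. l \<le> 2 * k - 1 \<Longrightarrow> f l \<in> carrier_mat q q \<and> hermitian_mat (f l)"
    and X: "X \<in> carrier_mat (Suc k * q) q"
  shows "orth_mat f k \<in> carrier_mat q (Suc k * q)"
    and "mat_op q (orth_mat f k * X) = row_dot (Suc k) (orth_row f k) (\<lambda>l. block_op q X l 0)"
proof -
  obtain p where p: "k = Suc p" using k by (cases k) auto
  let ?Y = "blk_col q k (\<lambda>i. f (k + i))" and ?H = "minv (blk_hankel q f (k - 1))"
  have H: "?H \<in> carrier_mat (k * q) (k * q)"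
    using minv_inverse(1)[OF blk_hankel_carrier posdef_mat_right_inverse[OF blk_hankel_carrier pd]] p
    by simp
  have Y: "mat_adjoint ?Y \<in> carrier_mat q (k * q)" by simp
  have YH: "mat_adjoint ?Y * ?H \<in> carrier_mat q (k * q)" by (rule mult_carrier_mat[OF Y H])
  show carrier: "orth_mat f k \<in> carrier_mat q (Suc k * q)"
    unfolding orth_mat_def by (intro blk_row_I_carrier uminus_carrier_mat YH)
  have adj: "block_op q (mat_adjoint ?Y) 0 i = mat_op q (f (k + i))" if "i < k" for i
    using that f[of "k + i"] block_op_adjoint_blk_col[of i k "\<lambda>i. f (k + i)"]
    by (auto simp: hermitian_mat_def)
  have row: "block_op q (mat_adjoint ?Y * ?H) 0 l = hankel_row f (k - 1) (\<lambda>i. mat_op q (f (k + i))) l"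
    if "l < k" for l
    using block_op_mult_row[OF Y H that]
    by (simp add: adj hankel_row_def del: sum.lessThan_Suc mult_Suc)
      (simp add: p del: sum.lessThan_Suc)
  have "block_op q (orth_mat f k) 0 l = orth_row f k l" if "l \<le> k" for l
    using that row[of l] block_op_blk_row_I[OF q uminus_carrier_mat[OF YH] that]
      block_op_uminus[OF q, of "mat_adjoint ?Y * ?H" 1 k 0 l] YH
    by (auto simp: orth_mat_def orth_row_def)
  then show "mat_op q (orth_mat f k * X) = row_dot (Suc k) (orth_row f k) (\<lambda>l. block_op q X l 0)"
    using block_op_mult_row_col[OF carrier X]
    by (simp add: row_dot_def del: sum.lessThan_Suc mult_Suc)
qed

end

section \<open>The moment data\<close>

lemma blk2_carrier:
  assumes "A \<in> carrier_mat q q" "B \<in> carrier_mat q q" "C \<in> carrier_mat q q" "D \<in> carrier_mat q q"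
  shows "four_block_mat A B C D \<in> carrier_mat (2 * q) (2 * q)"
  using four_block_carrier_mat[OF assms(1,4), of B C] by (simp add: mult_2)

lemma hankel_row_uminus: "hankel_row q f k (\<lambda>i. - r i) = (\<lambda>l. - hankel_row q f k r l)"
  if "0 < q"
  using that by (simp add: hankel_row_def sum_negf fun_eq_iff)

locale moment_data =
  fixes q n :: nat and a b :: real and s :: "nat \<Rightarrow> complex mat" and z :: complex
  assumes q: "q \<ge> 1" and n: "n \<ge> 1" and ab: "a < b"
    and s_herm: "\<And>j. j \<le> 2 * n + 1 \<Longrightarrow> s j \<in> carrier_mat q q \<and> hermitian_mat (s j)"
    and pd_H1: "posdef_mat (H1 q s n)"
    and pd_H2: "posdef_mat (H2 q a b s (n - 1))"
    and pd_K1: "posdef_mat (K1 q b s n)"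
    and pd_K2: "posdef_mat (K2 q a s n)"
begin

lemma q_pos: "0 < q" using q by simp

definition kap :: "nat \<Rightarrow> complex mat" where
  "kap i = complex_of_real b \<cdot>\<^sub>m s i - s (Suc i)"

definition tau :: "nat \<Rightarrow> complex mat" where
  "tau i = - (complex_of_real a \<cdot>\<^sub>m s i) + s (Suc i)"

abbreviation \<alpha> :: seq_op where "\<alpha> \<equiv> scalar_op (complex_of_real a)"
abbreviation \<beta> :: seq_op where "\<beta> \<equiv> scalar_op (complex_of_real b)"
abbreviation \<sigma> :: "nat \<Rightarrow> seq_op" where "\<sigma> l \<equiv> mat_op q (s l)"

lemma s_carrier: "l \<le> 2 * n + 1 \<Longrightarrow> s l \<in> carrier_mat q q"
  using s_herm by blast

lemma kap: "l \<le> 2 * n \<Longrightarrow> kap l \<in> carrier_mat q q \<and> hermitian_mat (kap l)"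
  using s_herm[of l] s_herm[of "Suc l"]
  by (auto simp: kap_def intro!: hermitian_mat_diff hermitian_mat_smult)

lemma tau: "l \<le> 2 * n \<Longrightarrow> tau l \<in> carrier_mat q q \<and> hermitian_mat (tau l)"
  using s_herm[of l] s_herm[of "Suc l"]
  by (auto simp: tau_def intro!: hermitian_mat_add hermitian_mat_smult hermitian_mat_uminus)

lemma shat: "l \<le> 2 * n - 1 \<Longrightarrow> shat a b s l \<in> carrier_mat q q \<and> hermitian_mat (shat a b s l)"
proof -
  assume "l \<le> 2 * n - 1"
  then have s: "s l \<in> carrier_mat q q" "s (Suc l) \<in> carrier_mat q q" "s (Suc (Suc l)) \<in> carrier_mat q q"
    and h: "hermitian_mat (s l)" "hermitian_mat (s (Suc l))" "hermitian_mat (s (Suc (Suc l)))"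
    using n by (simp_all add: s_herm)
  have r: "- complex_of_real (a * b) = complex_of_real (- (a * b))" by simp
  show ?thesis
    unfolding shat_def r using s h
    by (intro conjI minus_carrier_mat hermitian_mat_diff[of _ q] hermitian_mat_add[of _ q]
        hermitian_mat_smult add_carrier_mat smult_carrier_mat)
qed

lemma mat_op_kap: "l \<le> 2 * n \<Longrightarrow> mat_op q (kap l) = \<beta> * \<sigma> l - \<sigma> (Suc l)"
  by (simp add: kap_def mat_op_diff[OF q_pos] mat_op_smult[OF q_pos] s_carrier)

lemma mat_op_tau: "l \<le> 2 * n \<Longrightarrow> mat_op q (tau l) = \<sigma> (Suc l) - \<alpha> * \<sigma> l"
  by (simp add: tau_def mat_op_add[OF q_pos] mat_op_uminus[OF q_pos] mat_op_smult[OF q_pos] s_carrier)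

lemma mat_op_shat:
  assumes "l \<le> 2 * n - 1"
  shows "mat_op q (shat a b s l) =
    \<beta> * \<sigma> (Suc l) - \<sigma> (Suc (Suc l)) - \<alpha> * (\<beta> * \<sigma> l - \<sigma> (Suc l))"
proof -
  have "s l \<in> carrier_mat q q" "s (Suc l) \<in> carrier_mat q q" "s (Suc (Suc l)) \<in> carrier_mat q q"
    using assms n by (simp_all add: s_carrier)
  then have "mat_op q (shat a b s l) = scalar_op (- complex_of_real (a * b)) * \<sigma> l
      + scalar_op (complex_of_real (a + b)) * \<sigma> (Suc l) - \<sigma> (Suc (Suc l))"
    unfolding shat_def
    by (simp only: mat_op_diff[OF q_pos] mat_op_add[OF q_pos] mat_op_smult[OF q_pos]
        add_carrier_mat smult_carrier_mat)
  then show ?thesis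
    by (simp add: scalar_op_uminus scalar_op_mult scalar_op_add algebra_simps)
qed

lemma posdef_kap: "k \<le> n \<Longrightarrow> posdef_mat (blk_hankel q kap k)"
  using posdef_blk_hankel_mono[of q kap n k] pd_K1 by (simp add: K1_def kap_def[abs_def])

lemma posdef_tau: "k \<le> n \<Longrightarrow> posdef_mat (blk_hankel q tau k)"
  using posdef_blk_hankel_mono[of q tau n k] pd_K2 by (simp add: K2_def tau_def[abs_def])

lemma posdef_shat: "k \<le> n - 1 \<Longrightarrow> posdef_mat (blk_hankel q (shat a b s) k)"
  using posdef_blk_hankel_mono[of q "shat a b s" "n - 1" k] pd_H2 by (simp add: H2_def)

text \<open>A Hankel matrix with last index \<open>k - 1\<close> has \<open>k\<close> block rows, so
  the row has length \<open>k\<close>. At \<open>k = 0\<close> the truncated subtraction is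
  harmless, since a pairing of length 0 reads no coefficient.\<close>

definition F_row :: "nat \<Rightarrow> nat \<Rightarrow> seq_op" where
  "F_row k = hankel_row q kap (k - 1) (\<lambda>i. \<alpha> ^ i)"

definition E_row :: "nat \<Rightarrow> nat \<Rightarrow> seq_op" where
  "E_row k = hankel_row q (shat a b s) (k - 1) (\<lambda>i. mat_op q (kap i))"

definition J_row :: "nat \<Rightarrow> seq_op" where
  "J_row = hankel_row q s n (\<lambda>i. - (\<alpha> ^ i))"

text \<open>The point is \<open>cnj z\<close> because the adjoint of U contains the polynomials at
  the conjugate point.\<close>

sublocale rows: moment_rows_final \<alpha> \<beta> \<sigma> F_row E_row n "scalar_op (cnj z)" J_row
proof unfold_locales
  fix x :: seq_op
  show "\<alpha> * x = x * \<alpha>" "\<beta> * x = x * \<beta>" "scalar_op (cnj z) * x = x * scalar_op (cnj z)"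
    by (rule scalar_op_central)+
next
  fix k assume "k < n"
  then show "hankel_regular (\<lambda>l. \<beta> * \<sigma> l - \<sigma> (Suc l)) (Suc k)"
    by (intro hankel_regular_blk_hankel[OF q_pos posdef_kap[of k]]) (simp_all add: mat_op_kap)
next
  fix k assume k: "k \<le> n"
  show "hankel_regular (\<lambda>l. \<beta> * \<sigma> (Suc l) - \<sigma> (Suc (Suc l)) - \<alpha> * (\<beta> * \<sigma> l - \<sigma> (Suc l))) k"
  proof (cases k)
    case 0
    then show ?thesis by (simp add: hankel_regular_def)
  next
    case (Suc p)
    then show ?thesis
      using k hankel_regular_blk_hankel[OF q_pos posdef_shat[of p]] by (simp add: mat_op_shat)
  qed
next
  fix k m assume k: "k \<le> n" and m: "m < k"
  then obtain p where p: "k = Suc p" by (cases k) auto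
  show "row_dot k (F_row k) (\<lambda>l. \<beta> * \<sigma> (l + m) - \<sigma> (Suc (l + m))) = \<alpha> ^ m"
    using row_dot_hankel_row[OF q_pos posdef_kap[of p], of "\<lambda>l. \<beta> * \<sigma> l - \<sigma> (Suc l)" m] k m
    by (simp add: p F_row_def mat_op_kap)
  have "row_dot (Suc p) (E_row k) (\<lambda>l. \<beta> * \<sigma> (Suc (l + m)) - \<sigma> (Suc (Suc (l + m)))
      - \<alpha> * (\<beta> * \<sigma> (l + m) - \<sigma> (Suc (l + m)))) = mat_op q (kap m)"
    unfolding E_row_def p diff_Suc_1
    by (rule row_dot_hankel_row[OF q_pos posdef_shat[of p], of
          "\<lambda>l. \<beta> * \<sigma> (Suc l) - \<sigma> (Suc (Suc l)) - \<alpha> * (\<beta> * \<sigma> l - \<sigma> (Suc l))" m])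
      (use k m p in \<open>simp_all add: mat_op_shat\<close>)
  then show "row_dot k (E_row k) (\<lambda>l. \<beta> * \<sigma> (Suc (l + m)) - \<sigma> (Suc (Suc (l + m)))
      - \<alpha> * (\<beta> * \<sigma> (l + m) - \<sigma> (Suc (l + m)))) = \<beta> * \<sigma> m - \<sigma> (Suc m)"
    using k m by (simp add: p mat_op_kap)
next
  fix m assume "m \<le> n"
  then show "row_dot (Suc n) J_row (\<lambda>l. \<sigma> (l + m)) = - (\<alpha> ^ m)"
    using row_dot_hankel_row[OF q_pos, of s n \<sigma> m] pd_H1 by (simp add: J_row_def H1_def)
qed

lemma \<kappa>_eq: "l \<le> 2 * n \<Longrightarrow> rows.\<kappa> l = mat_op q (kap l)"
  by (simp add: rows.\<kappa>_def mat_op_kap)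

section \<open>The DSM parameters as pairings of rows\<close>

lemma vvec_carrier: "vvec q j \<in> carrier_mat (Suc j * q) q"
  unfolding vvec_def by (rule blk_col_carrier)

lemma block_op_vvec: "l \<le> j \<Longrightarrow> block_op q (vvec q j) l 0 = (if l = 0 then 1 else 0)"
  by (simp add: vvec_def block_op_blk_col[OF q_pos] mat_op_one[OF q_pos] mat_op_zero[OF q_pos])

lemma block_op_Rmat_vvec:
  "l \<le> j \<Longrightarrow> block_op q (Rmat q j x * vvec q j) l 0 = scalar_op x ^ l"
  by (induction l)
    (simp_all add: block_op_Rmat_mult[OF q_pos vvec_carrier] block_op_vvec)

lemma Rmat_vvec_eq: "Rmat q j x * vvec q j = blk_col q (Suc j) (\<lambda>i. x ^ i \<cdot>\<^sub>m 1\<^sub>m q)"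
proof (rule block_op_eqI[OF q_pos, of _ "Suc j" 1])
  fix i l :: nat assume "i < Suc j" "l < 1"
  then show "block_op q (Rmat q j x * vvec q j) i l =
      block_op q (blk_col q (Suc j) (\<lambda>i. x ^ i \<cdot>\<^sub>m 1\<^sub>m q)) i l"
    by (simp add: block_op_Rmat_vvec block_op_blk_col[OF q_pos] mat_op_smult[OF q_pos]
        mat_op_one[OF q_pos] scalar_op_power)
qed (use Rmat_mult_carrier[OF q_pos vvec_carrier] in \<open>simp_all del: mult_Suc One_nat_def\<close>)

lemma adjoint_form_assoc:
  assumes w: "w \<in> carrier_mat (Suc k * q) q" and M: "M \<in> carrier_mat (Suc k * q) (Suc k * q)"
  shows "mat_adjoint w * mat_adjoint (Rmat q k x) * M * Rmat q k x * w =
    mat_adjoint (Rmat q k x * w) * M * (Rmat q k x * w)"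
proof -
  let ?N = "Suc k * q"
  note R = Rmat_inverse(1)[OF q_pos, of k x]
  have wR: "mat_adjoint (Rmat q k x * w) = mat_adjoint w * mat_adjoint (Rmat q k x)"
    by (rule mat_adjoint_mult[OF R w])
  have "mat_adjoint (Rmat q k x * w) * M \<in> carrier_mat q ?N"
    by (rule mult_carrier_mat[OF mat_adjoint_carrier[OF mult_carrier_mat[OF R w]] M])
  then show ?thesis
    using assoc_mult_mat[OF _ R w] unfolding wR by blast
qed

text \<open>R(a) v is the column of powers of \<open>a\<close>, so mu is the quadratic form of these
  powers, which is the kernel row of \<kappa> evaluated at \<open>a\<close>.\<close>

lemma mu:
  assumes k: "k < n"
  shows "mat_op q (mu q a b s k) = rows.M (Suc k)"
    and "hermitian_mat (mu q a b s k)" and "mu q a b s k \<in> carrier_mat q q"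
proof -
  let ?V = "blk_col q (Suc k) (\<lambda>i. complex_of_real a ^ i \<cdot>\<^sub>m 1\<^sub>m q)"
  note pd = posdef_kap[OF less_imp_le[OF k]]
  have mu: "mu q a b s k = mat_adjoint ?V * minv (blk_hankel q kap k) * ?V"
    unfolding mu_def Let_def K1_def kap_def[abs_def, symmetric]
      adjoint_form_assoc[OF vvec_carrier minv_inverse(1)[OF blk_hankel_carrier
          posdef_mat_right_inverse[OF blk_hankel_carrier pd]]] Rmat_vvec_eq ..
  have g: "complex_of_real a ^ i \<cdot>\<^sub>m 1\<^sub>m q \<in> carrier_mat q q
      \<and> hermitian_mat (complex_of_real a ^ i \<cdot>\<^sub>m 1\<^sub>m q)" for i
    by (simp add: hermitian_mat_def mat_adjoint_smult)
  note form = mat_op_quadratic_form[OF q_pos pd, of "\<lambda>i. complex_of_real a ^ i \<cdot>\<^sub>m 1\<^sub>m q", OF g,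
      folded mu]
  show "hermitian_mat (mu q a b s k)" "mu q a b s k \<in> carrier_mat q q"
    using form(2,3) by blast+
  have "mat_op q (complex_of_real a ^ i \<cdot>\<^sub>m 1\<^sub>m q) = \<alpha> ^ i" for i
    by (simp add: mat_op_smult[OF q_pos] mat_op_one[OF q_pos] scalar_op_power)
  then show "mat_op q (mu q a b s k) = rows.M (Suc k)"
    using form(1) by (simp add: rows.M_def F_row_def)
qed

text \<open>The recursion of R(a) telescopes: it starts at -(a + b) s_0 + s_1 + a s_0 = -kap_0, and
  -shat_i - a kap_i = -kap_{i+1}.\<close>

lemma second_kind_col:
  assumes k: "k < n"
  defines "w \<equiv> u2 q a b s k + complex_of_real a \<cdot>\<^sub>m (vvec q k * s 0)"
  shows "w \<in> carrier_mat (Suc k * q) q"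
    and "i \<le> k \<Longrightarrow> block_op q (Rmat q k (complex_of_real a) * w) i 0 = - mat_op q (kap i)"
proof -
  have v1: "vvec q k \<in> carrier_mat (Suc k * q) (Suc 0 * q)" and s1: "s 0 \<in> carrier_mat (Suc 0 * q) q"
    using vvec_carrier[of k] s_carrier[of 0] by simp_all
  have vs: "vvec q k * s 0 \<in> carrier_mat (Suc k * q) (1 * q)"
    using mult_carrier_mat[OF vvec_carrier s_carrier] by simp
  have u2: "u2 q a b s k \<in> carrier_mat (Suc k * q) (1 * q)" by (simp add: u2_def del: mult_Suc One_nat_def)
  show w: "w \<in> carrier_mat (Suc k * q) q"
    using vs u2 by (simp add: w_def del: mult_Suc One_nat_def)
  have w_block: "block_op q w i 0 = block_op q (u2 q a b s k) i 0 + (if i = 0 then \<alpha> * \<sigma> 0 else 0)"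
    if "i \<le> k" for i
    using that block_op_add[OF q_pos u2 smult_carrier_mat[OF vs], of i 0]
      block_op_mult_col[OF q_pos v1 s1, of i]
    by (simp add: w_def block_op_smult[OF q_pos vs] block_op_vvec del: mult_Suc)
  show "block_op q (Rmat q k (complex_of_real a) * w) i 0 = - mat_op q (kap i)"
    if "i \<le> k" for i
    using that
  proof (induction i)
    case 0
    have "mat_op q (u20 a b s) = - (scalar_op (complex_of_real (a + b)) * \<sigma> 0) + \<sigma> (Suc 0)"
      using n by (simp add: u20_def mat_op_add[OF q_pos] mat_op_uminus[OF q_pos]
          mat_op_smult[OF q_pos] s_carrier)
    then show ?case
      by (simp add: block_op_Rmat_mult[OF q_pos w] w_block u2_def block_op_blk_col[OF q_pos]
          mat_op_kap scalar_op_add algebra_simps)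
  next
    case (Suc i)
    then have sh: "shat a b s i \<in> carrier_mat q q" using k by (simp add: shat)
    have IH: "block_op q (Rmat q k (complex_of_real a) * w) i 0 = \<sigma> (Suc i) - \<beta> * \<sigma> i"
      using Suc k by (simp add: mat_op_kap)
    show ?case
      using Suc.prems k sh
      by (simp add: IH block_op_Rmat_mult[OF q_pos w] w_block u2_def block_op_blk_col[OF q_pos]
          mat_op_uminus[OF q_pos] mat_op_shat mat_op_kap algebra_simps)
  qed
qed

text \<open>By \<open>second_kind_col\<close>, lambda is a quadratic form in the column of -kap_i;
  the two signs cancel.\<close>

lemma lam:
  assumes k: "k < n"
  shows "mat_op q (lam q a b s k) = rows.L (Suc k)"
    and "hermitian_mat (lam q a b s k)" and "lam q a b s k \<in> carrier_mat q q"
proof -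
  let ?w = "u2 q a b s k + complex_of_real a \<cdot>\<^sub>m (vvec q k * s 0)"
  let ?V = "blk_col q (Suc k) (\<lambda>i. - kap i)"
  have pd: "posdef_mat (blk_hankel q (shat a b s) k)" using k by (intro posdef_shat) simp
  note w = second_kind_col(1)[OF k] and Rw = second_kind_col(2)[OF k]
  have "Rmat q k (complex_of_real a) * ?w = ?V"
  proof (rule block_op_eqI[OF q_pos, of _ "Suc k" 1])
    fix i l :: nat assume "i < Suc k" "l < 1"
    then show "block_op q (Rmat q k (complex_of_real a) * ?w) i l = block_op q ?V i l"
      using k kap[of i] by (simp add: Rw block_op_blk_col[OF q_pos] mat_op_uminus[OF q_pos])
  qed (use Rmat_mult_carrier[OF q_pos w] in \<open>simp_all del: mult_Suc One_nat_def\<close>)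
  then have lam: "lam q a b s k = mat_adjoint ?V * minv (blk_hankel q (shat a b s) k) * ?V"
    unfolding lam_def Let_def H2_def
      adjoint_form_assoc[OF w minv_inverse(1)[OF blk_hankel_carrier
          posdef_mat_right_inverse[OF blk_hankel_carrier pd]]] by (rule arg_cong)
  have g: "- kap i \<in> carrier_mat q q \<and> hermitian_mat (- kap i)" if "i \<le> k" for i
    using that k kap[of i] by (simp add: hermitian_mat_uminus)
  note form = mat_op_quadratic_form[OF q_pos pd, of "\<lambda>i. - kap i", OF g, folded lam]
  show "hermitian_mat (lam q a b s k)" "lam q a b s k \<in> carrier_mat q q"
    using form(2,3) by blast+
  have neg: "mat_op q (- kap i) = - mat_op q (kap i)" if "i \<le> k" for i
    using that k kap[of i] by (simp add: mat_op_uminus[OF q_pos])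
  have "hankel_row q (shat a b s) k (\<lambda>i. mat_op q (- kap i)) =
      hankel_row q (shat a b s) k (\<lambda>i. - mat_op q (kap i))"
    by (auto simp: hankel_row_def[OF q_pos] neg fun_eq_iff intro!: sum.cong)
  moreover have "row_dot (Suc k) c (\<lambda>l. mat_op q (- kap l)) = - row_dot (Suc k) c rows.\<kappa>" for c
    unfolding row_dot_uminus_right[symmetric]
    by (rule row_dot_cong) (use k in \<open>simp add: neg \<kappa>_eq\<close>)
  ultimately show "mat_op q (lam q a b s k) = rows.L (Suc k)"
    using form(1)
    by (simp add: rows.L_def E_row_def hankel_row_uminus[OF q_pos] row_dot_uminus_left)
qed

end

lemma orth_mat_Rmat_mult:
  assumes q: "0 < q" and k: "0 < k" and pd: "posdef_mat (blk_hankel q f (k - 1))"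
    and f: "\<And>l. l \<le> 2 * k - 1 \<Longrightarrow> f l \<in> carrier_mat q q \<and> hermitian_mat (f l)"
    and C: "C \<in> carrier_mat (Suc k * q) q"
  shows "orth_mat q f k * Rmat q k x * C \<in> carrier_mat q q"
    and "mat_op q (orth_mat q f k * Rmat q k x * C) =
      row_dot (Suc k) (orth_row q f k) (\<lambda>l. block_op q (Rmat q k x * C) l 0)"
proof -
  have RC: "Rmat q k x * C \<in> carrier_mat (Suc k * q) q" by (rule Rmat_mult_carrier[OF q C])
  note W = orth_mat_mult[OF q k pd f RC]
  have assoc: "orth_mat q f k * Rmat q k x * C = orth_mat q f k * (Rmat q k x * C)"
    by (rule assoc_mult_mat[OF W(1) Rmat_inverse(1)[OF q] C])
  show "orth_mat q f k * Rmat q k x * C \<in> carrier_mat q q"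
    unfolding assoc by (rule mult_carrier_mat[OF W(1) RC])
  show "mat_op q (orth_mat q f k * Rmat q k x * C) =
      row_dot (Suc k) (orth_row q f k) (\<lambda>l. block_op q (Rmat q k x * C) l 0)"
    unfolding assoc by (rule W(2))
qed

section \<open>The polynomials of the resolvent matrix and their values at a\<close>

context moment_data
begin

abbreviation \<omega> :: seq_op where "\<omega> \<equiv> scalar_op (cnj z)"

lemma kap_orthogonal: "m < n \<Longrightarrow> row_dot (Suc n) (orth_row q kap n) (\<lambda>l. rows.\<kappa> (l + m)) = 0"
  by (rule orth_row_orthogonal[OF q_pos posdef_kap]) (simp_all add: \<kappa>_eq)

lemma tau_orthogonal:
  "m < n \<Longrightarrow> row_dot (Suc n) (orth_row q tau n) (\<lambda>l. \<sigma> (Suc (l + m)) - \<alpha> * \<sigma> (l + m)) = 0"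
  by (rule orth_row_orthogonal[OF q_pos posdef_tau, of n "\<lambda>l. \<sigma> (Suc l) - \<alpha> * \<sigma> l"])
    (simp_all add: mat_op_tau)

lemma shat_orthogonal:
  "m < n - 1 \<Longrightarrow> row_dot n (orth_row q (shat a b s) (n - 1))
    (\<lambda>l. rows.\<kappa> (Suc (l + m)) - \<alpha> * rows.\<kappa> (l + m)) = 0"
  using orth_row_orthogonal[OF q_pos posdef_shat, of "n - 1" "\<lambda>l. rows.\<kappa> (Suc l) - \<alpha> * rows.\<kappa> l" m] n
  by (simp add: rows.\<kappa>_def mat_op_shat)

lemma Gam1_eq: "Gam1 q b s n x = orth_mat q kap n * Rmat q n x * vvec q n"
  using n by (simp add: Gam1_def orth_mat_def[OF q_pos] Yt1_def K1_def kap_def[abs_def])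

lemma The1_eq: "The1 q b s n x = orth_mat q kap n * Rmat q n x * ut1 q b s n"
  using n by (simp add: The1_def orth_mat_def[OF q_pos] Yt1_def K1_def kap_def[abs_def])

lemma Gam2_eq: "Gam2 q a s n x = orth_mat q tau n * Rmat q n x * vvec q n"
  using n by (simp add: Gam2_def orth_mat_def[OF q_pos] Yt2_def K2_def tau_def[abs_def])

lemma The2_eq: "The2 q a s n x = orth_mat q tau n * Rmat q n x * ut2 q a s n"
  using n by (simp add: The2_def orth_mat_def[OF q_pos] Yt2_def K2_def tau_def[abs_def])

lemma ut1_carrier: "ut1 q b s n \<in> carrier_mat (Suc n * q) q"
  unfolding ut1_def by (rule blk_col_carrier)

lemma ut2_carrier: "ut2 q a s n \<in> carrier_mat (Suc n * q) q"
  unfolding ut2_def by (rule blk_col_carrier)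

lemma orth_mat_kap:
  assumes "C \<in> carrier_mat (Suc n * q) q"
  shows "orth_mat q kap n * Rmat q n x * C \<in> carrier_mat q q"
    and "mat_op q (orth_mat q kap n * Rmat q n x * C) =
      row_dot (Suc n) (orth_row q kap n) (\<lambda>l. block_op q (Rmat q n x * C) l 0)"
  using orth_mat_Rmat_mult[OF q_pos _ posdef_kap _ assms, of x] kap n by simp_all

lemma orth_mat_tau:
  assumes "C \<in> carrier_mat (Suc n * q) q"
  shows "orth_mat q tau n * Rmat q n x * C \<in> carrier_mat q q"
    and "mat_op q (orth_mat q tau n * Rmat q n x * C) =
      row_dot (Suc n) (orth_row q tau n) (\<lambda>l. block_op q (Rmat q n x * C) l 0)"
  using orth_mat_Rmat_mult[OF q_pos _ posdef_tau _ assms, of x] tau n by simp_all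

lemma carriers:
  "Gam1 q b s n x \<in> carrier_mat q q" "The1 q b s n x \<in> carrier_mat q q"
  "Gam2 q a s n x \<in> carrier_mat q q" "The2 q a s n x \<in> carrier_mat q q"
  by (simp_all only: Gam1_eq The1_eq Gam2_eq The2_eq orth_mat_kap orth_mat_tau
      vvec_carrier ut1_carrier ut2_carrier)

lemma block_op_ut1:
  "block_op q (ut1 q b s n) 0 0 = \<sigma> 0"
  "l < n \<Longrightarrow> block_op q (ut1 q b s n) (Suc l) 0 = - rows.\<kappa> l"
  by (simp_all add: ut1_def block_op_blk_col[OF q_pos] mat_op_diff[OF q_pos]
      mat_op_smult[OF q_pos] s_carrier rows.\<kappa>_def)

lemma block_op_Rmat_ut1: "l \<le> n \<Longrightarrow> block_op q (Rmat q n (cnj z) * ut1 q b s n) l 0 = rows.\<theta> l"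
  by (induction l) (simp_all add: block_op_Rmat_mult[OF q_pos ut1_carrier] block_op_ut1)

lemma block_op_ut2:
  "block_op q (ut2 q a s n) 0 0 = - \<sigma> 0"
  "l < n \<Longrightarrow> block_op q (ut2 q a s n) (Suc l) 0 = \<alpha> * \<sigma> l - \<sigma> (Suc l)"
  by (simp_all add: ut2_def block_op_blk_col[OF q_pos] mat_op_uminus[OF q_pos] mat_op_diff[OF q_pos]
      mat_op_smult[OF q_pos] s_carrier)

lemma block_op_Rmat_ut2: "l \<le> n \<Longrightarrow> block_op q (Rmat q n (cnj z) * ut2 q a s n) l 0 = rows.t l"
  by (induction l) (simp_all add: block_op_Rmat_mult[OF q_pos ut2_carrier] block_op_ut2)

text \<open>At \<open>a\<close> the recursion telescopes: a (-s_l) + (a s_l - s_{l+1}) =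
  -s_{l+1}.\<close>

lemma block_op_Rmat_ut2_at_a:
  "l \<le> n \<Longrightarrow> block_op q (Rmat q n (complex_of_real a) * ut2 q a s n) l 0 = - \<sigma> l"
  by (induction l) (simp_all add: block_op_Rmat_mult[OF q_pos ut2_carrier] block_op_ut2)

lemma mat_op_Gam1:
  "mat_op q (Gam1 q b s n x) = row_dot (Suc n) (orth_row q kap n) (\<lambda>l. scalar_op x ^ l)"
  by (auto simp: Gam1_eq orth_mat_kap(2)[OF vvec_carrier] block_op_Rmat_vvec intro: row_dot_cong)

lemma mat_op_Gam2:
  "mat_op q (Gam2 q a s n x) = row_dot (Suc n) (orth_row q tau n) (\<lambda>l. scalar_op x ^ l)"
  by (auto simp: Gam2_eq orth_mat_tau(2)[OF vvec_carrier] block_op_Rmat_vvec intro: row_dot_cong)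

lemma mat_op_The1:
  "mat_op q (The1 q b s n (cnj z)) = row_dot (Suc n) (orth_row q kap n) rows.\<theta>"
  by (auto simp: The1_eq orth_mat_kap(2)[OF ut1_carrier] block_op_Rmat_ut1 intro: row_dot_cong)

lemma mat_op_The2:
  "mat_op q (The2 q a s n (cnj z)) = row_dot (Suc n) (orth_row q tau n) rows.t"
  by (auto simp: The2_eq orth_mat_tau(2)[OF ut2_carrier] block_op_Rmat_ut2 intro: row_dot_cong)

lemma mat_op_The2_at_a:
  "mat_op q (The2 q a s n (complex_of_real a)) = - row_dot (Suc n) (orth_row q tau n) \<sigma>"
  unfolding row_dot_uminus_right[symmetric]
  by (auto simp: The2_eq orth_mat_tau(2)[OF ut2_carrier] block_op_Rmat_ut2_at_a intro: row_dot_cong)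

text \<open>Gamma_1 and Theta_1 pair one and the same row, orthogonal to \<kappa>, with two
  different sequences, so both have the left factor Gamma_1(a).\<close>

lemma Gam1_factor:
  "mat_op q (Gam1 q b s n (cnj z)) =
    mat_op q (Gam1 q b s n (complex_of_real a)) * rows.G n (\<lambda>l. \<omega> ^ l)"
  "mat_op q (The1 q b s n (cnj z)) = mat_op q (Gam1 q b s n (complex_of_real a)) * rows.G n rows.\<theta>"
  unfolding mat_op_Gam1 mat_op_The1
  by (rule rows.annihilator_of_\<kappa>[OF order_refl kap_orthogonal], assumption)+

lemma Gam1_right_inverse:
  "\<exists>B \<in> carrier_mat q q. Gam1 q b s n (complex_of_real a) * B = 1\<^sub>m q"
proof -
  have "orth_row q kap n n = 1" by (simp add: orth_row_def[OF q_pos])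
  then obtain X where "mat_op q (Gam1 q b s n (complex_of_real a)) * X = 1"
    using rows.annihilator_normalised[OF kap_orthogonal] unfolding mat_op_Gam1 by blast
  then show ?thesis by (rule mat_op_right_inverse[OF q_pos carriers(1)])
qed

text \<open>The weight of K_2 consists of the differences s_{l+1} - a s_l, so its orthogonal row is
  a multiple of the kernel row \<open>- J_row\<close> of the moments; the factor, its pairing with
  the moments, is minus Theta_2(a).\<close>

lemma tau_factor:
  "row_dot (Suc n) (orth_row q tau n) x =
    mat_op q (The2 q a s n (complex_of_real a)) * row_dot (Suc n) J_row x"
proof -
  have "hankel_regular \<sigma> (Suc n)"
    using hankel_regular_blk_hankel[OF q_pos, of s n \<sigma>] pd_H1 by (simp add: H1_def)
  then have "row_dot (Suc n) (orth_row q tau n) x = row_dot (Suc n) (orth_row q tau n) \<sigma> *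
      row_dot (Suc n) (\<lambda>l. - J_row l) x"
    using rows.J tau_orthogonal
    by (intro annihilator_of_differences[OF rows.a_central]) (simp_all add: row_dot_uminus_left)
  then show ?thesis by (simp add: mat_op_The2_at_a row_dot_uminus_left)
qed

lemma Q2_P2_carrier:
  "P2 q a b s (n - 1) x \<in> carrier_mat q q" "Q2 q a b s (n - 1) (complex_of_real a) \<in> carrier_mat q q"
  and mat_op_P2:
  "mat_op q (P2 q a b s (n - 1) x) = row_dot n (orth_row q (shat a b s) (n - 1)) (\<lambda>l. scalar_op x ^ l)"
  and mat_op_Q2: "mat_op q (Q2 q a b s (n - 1) (complex_of_real a)) =
    row_dot n (orth_row q (shat a b s) (n - 1)) rows.\<kappa>"
proof -
  obtain p where p: "n = Suc p" using n by (cases n) auto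
  let ?c = "row_dot n (orth_row q (shat a b s) (n - 1))"
  have "P2 q a b s p x \<in> carrier_mat q q \<and> Q2 q a b s p (complex_of_real a) \<in> carrier_mat q q \<and>
    mat_op q (P2 q a b s p x) = ?c (\<lambda>l. scalar_op x ^ l) \<and>
    mat_op q (Q2 q a b s p (complex_of_real a)) = ?c rows.\<kappa>"
  proof (cases "p = 0")
    case True
    have c: "?c y = y 0" for y
      using True by (simp add: p row_dot_def orth_row_def[OF q_pos])
    have u: "u20 a b s \<in> carrier_mat q q" "s 0 \<in> carrier_mat q q" "s (Suc 0) \<in> carrier_mat q q"
      using n by (simp_all add: u20_def s_carrier)
    have "mat_op q (u20 a b s) = - (scalar_op (complex_of_real (a + b)) * \<sigma> 0) + \<sigma> (Suc 0)"
      using u by (simp add: u20_def mat_op_add[OF q_pos] mat_op_uminus[OF q_pos] mat_op_smult[OF q_pos])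
    then have "mat_op q (- (u20 a b s + complex_of_real a \<cdot>\<^sub>m s 0)) = rows.\<kappa> 0"
      using u by (simp add: mat_op_add[OF q_pos] mat_op_uminus[OF q_pos] mat_op_smult[OF q_pos]
          rows.\<kappa>_def scalar_op_add algebra_simps)
    then show ?thesis
      using True u by (simp add: P2_def Q2_def c[simplified] mat_op_one[OF q_pos])
  next
    case False
    let ?w = "u2 q a b s p + complex_of_real a \<cdot>\<^sub>m (vvec q p * s 0)"
    let ?O = "orth_mat q (shat a b s) p"
    have pn: "p < n" by (simp add: p)
    note w = second_kind_col[OF pn]
    have P: "P2 q a b s p x = ?O * Rmat q p x * vvec q p"
      using False by (simp add: P2_def orth_mat_def[OF q_pos] Y2_def H2_def)
    have Q: "Q2 q a b s p (complex_of_real a) = - (?O * Rmat q p (complex_of_real a) * ?w)"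
      using False by (simp add: Q2_def orth_mat_def[OF q_pos] Y2_def H2_def)
    have pd: "posdef_mat (blk_hankel q (shat a b s) (p - 1))" by (rule posdef_shat) (simp add: p)
    have sh: "shat a b s l \<in> carrier_mat q q \<and> hermitian_mat (shat a b s l)" if "l \<le> 2 * p - 1" for l
      using that by (intro shat) (simp add: p)
    note O = orth_mat_Rmat_mult[OF q_pos _ pd sh]
    have "mat_op q (?O * Rmat q p x * vvec q p) = ?c (\<lambda>l. scalar_op x ^ l)"
      using O(2)[OF _ _ vvec_carrier, of x] False
      by (auto simp: p block_op_Rmat_vvec intro: row_dot_cong)
    moreover have "mat_op q (?O * Rmat q p (complex_of_real a) * ?w) = ?c (\<lambda>l. - rows.\<kappa> l)"
      using O(2)[OF _ _ w(1), of "complex_of_real a"] False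
      by (auto simp: p w(2) \<kappa>_eq intro: row_dot_cong)
    moreover have "?O * Rmat q p x * vvec q p \<in> carrier_mat q q"
      "?O * Rmat q p (complex_of_real a) * ?w \<in> carrier_mat q q"
      using O(1)[OF _ _ vvec_carrier, of x] O(1)[OF _ _ w(1), of "complex_of_real a"] False by simp_all
    ultimately show ?thesis
      by (simp add: P Q mat_op_uminus[OF q_pos] row_dot_uminus_right)
  qed
  then show "P2 q a b s (n - 1) x \<in> carrier_mat q q"
    "Q2 q a b s (n - 1) (complex_of_real a) \<in> carrier_mat q q"
    "mat_op q (P2 q a b s (n - 1) x) = ?c (\<lambda>l. scalar_op x ^ l)"
    "mat_op q (Q2 q a b s (n - 1) (complex_of_real a)) = ?c rows.\<kappa>"
    by (simp_all add: p)
qed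

text \<open>shat consists of the differences of \<kappa>, so the row of P_{2,n-1} is a multiple of
  the kernel row of \<kappa>. The factor is its pairing with \<kappa>, which is
  Q_{2,n-1}(a).\<close>

lemma shat_factor:
  "row_dot n (orth_row q (shat a b s) (n - 1)) x =
    mat_op q (Q2 q a b s (n - 1) (complex_of_real a)) * row_dot n (F_row n) x"
proof -
  obtain p where p: "n = Suc p" using n by (cases n) auto
  show ?thesis
    unfolding mat_op_Q2
    using annihilator_of_differences[OF rows.a_central rows.regular_\<kappa>[of p], of "F_row n"
        "orth_row q (shat a b s) p" x] rows.F_\<kappa>[of n] shat_orthogonal
    by (simp add: p)
qed

text \<open>Comparing leading coefficients in \<open>shat_factor\<close> writes 1 as Q_{2,n-1}(a)
  times the top coefficient of \<open>F_row n\<close>.\<close>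

lemma Q2_right_inverse:
  "\<exists>B \<in> carrier_mat q q. Q2 q a b s (n - 1) (complex_of_real a) * B = 1\<^sub>m q"
proof -
  obtain p where p: "n = Suc p" using n by (cases n) auto
  have "orth_row q (shat a b s) p p = mat_op q (Q2 q a b s p (complex_of_real a)) * F_row n p"
    by (rule row_dot_eq_coeff) (use shat_factor in \<open>simp add: p\<close>)
  then have "mat_op q (Q2 q a b s (n - 1) (complex_of_real a)) * F_row n p = 1"
    by (simp add: p orth_row_def[OF q_pos])
  then show ?thesis by (rule mat_op_right_inverse[OF q_pos Q2_P2_carrier(2)])
qed

text \<open>Evaluating \<open>shat_factor\<close> at \<open>a\<close> leaves the kernel row
  evaluated at \<open>a\<close>, which is mu. In particular this quotient is Hermitian.\<close>

lemma Q2_inverse_P2: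
  "minv (Q2 q a b s (n - 1) (complex_of_real a)) * P2 q a b s (n - 1) (complex_of_real a) =
    mu q a b s (n - 1)"
proof (rule mat_op_inject[OF q_pos])
  let ?Q = "Q2 q a b s (n - 1) (complex_of_real a)" and ?P = "P2 q a b s (n - 1) (complex_of_real a)"
  note inv = minv_inverse[OF Q2_P2_carrier(2) Q2_right_inverse]
  have mun: "n - 1 < n" using n by simp
  show "mu q a b s (n - 1) \<in> carrier_mat q q" by (rule mu(3)[OF mun])
  show "minv ?Q * ?P \<in> carrier_mat q q"
    using inv(1) Q2_P2_carrier(1) by (rule mult_carrier_mat)
  have "mat_op q (minv ?Q * ?P) = mat_op q (minv ?Q) * mat_op q ?Q * rows.M n"
    by (simp only: mat_op_mult[OF q_pos inv(1) Q2_P2_carrier(1)] mat_op_P2 shat_factor rows.M_def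
        mult.assoc)
  also have "mat_op q (minv ?Q) * mat_op q ?Q = 1"
    using mat_op_mult[OF q_pos inv(1) Q2_P2_carrier(2)] inv(3) by (simp add: mat_op_one[OF q_pos])
  finally show "mat_op q (minv ?Q * ?P) = mat_op q (mu q a b s (n - 1))"
    using mu(1)[OF mun] n by simp
qed

end

section \<open>The factorisation\<close>

lemma mat_prod_list_snoc:
  assumes "set As \<subseteq> carrier_mat d d" "B \<in> carrier_mat d d"
  shows "mat_prod_list d As \<in> carrier_mat d d"
    and "mat_prod_list d (As @ [B]) = mat_prod_list d As * B"
proof -
  show P: "mat_prod_list d As \<in> carrier_mat d d"
    using assms(1) by (induction As) (auto simp: mat_prod_list_def)
  show "mat_prod_list d (As @ [B]) = mat_prod_list d As * B"
    using assms(1)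
  proof (induction As)
    case Nil
    then show ?case using assms(2) by (simp add: mat_prod_list_def)
  next
    case (Cons A As)
    have "mat_prod_list d As \<in> carrier_mat d d"
      using Cons.prems by (induction As) (auto simp: mat_prod_list_def)
    then show ?case
      using Cons assms(2) by (simp add: mat_prod_list_def assoc_mult_mat[of _ d d _ d _ d])
  qed
qed

text \<open>The adjoint reverses products, so each new factor on the right acts as a block row
  operation on the adjoint of the partial product.\<close>

lemma block_op_adjoint_mult:
  assumes q: "0 < q" and A: "A \<in> carrier_mat (2 * q) (2 * q)" and B: "B \<in> carrier_mat (2 * q) (2 * q)"
    and ij: "i < 2" "j < 2"
  shows "block_op q (mat_adjoint (A * B)) i j =
    block_op q (mat_adjoint B) i 0 * block_op q (mat_adjoint A) 0 j +
    block_op q (mat_adjoint B) i (Suc 0) * block_op q (mat_adjoint A) (Suc 0) j"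
  unfolding mat_adjoint_mult[OF A B]
  using block_op_mult[OF q mat_adjoint_carrier[OF B] mat_adjoint_carrier[OF A] ij]
  by (simp add: numeral_2_eq_2)

lemma block_op_adjoint_blk2:
  assumes "0 < q" "A \<in> carrier_mat q q" "B \<in> carrier_mat q q" "C \<in> carrier_mat q q" "D \<in> carrier_mat q q"
  shows "block_op q (mat_adjoint (blk2 A B C D)) 0 0 = mat_op q (mat_adjoint A)"
    "block_op q (mat_adjoint (blk2 A B C D)) 0 (Suc 0) = mat_op q (mat_adjoint C)"
    "block_op q (mat_adjoint (blk2 A B C D)) (Suc 0) 0 = mat_op q (mat_adjoint B)"
    "block_op q (mat_adjoint (blk2 A B C D)) (Suc 0) (Suc 0) = mat_op q (mat_adjoint D)"
  using assms by (simp_all add: mat_adjoint_four_block_mat[OF assms(2-5)] block_op_four_block_mat)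

lemma mat_adjoint_quotient:
  assumes X: "X \<in> carrier_mat k k" and Y: "Y \<in> carrier_mat k k"
    and ex: "\<exists>B \<in> carrier_mat k k. Y * B = 1\<^sub>m k"
  shows "mat_adjoint X * minv (mat_adjoint Y) \<in> carrier_mat k k"
    and "mat_adjoint (mat_adjoint X * minv (mat_adjoint Y)) = minv Y * X"
proof -
  note inv = minv_inverse(1)[OF Y ex]
  show "mat_adjoint X * minv (mat_adjoint Y) \<in> carrier_mat k k"
    unfolding minv_adjoint[OF Y ex] using X inv by (intro mult_carrier_mat mat_adjoint_carrier)
  show "mat_adjoint (mat_adjoint X * minv (mat_adjoint Y)) = minv Y * X"
    unfolding minv_adjoint[OF Y ex]
    using mat_adjoint_mult[OF mat_adjoint_carrier[OF X] mat_adjoint_carrier[OF inv]] by simp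
qed

lemma invertible_mat_right_inverse:
  assumes A: "A \<in> carrier_mat k k" and inv: "invertible_mat A"
  shows "\<exists>B \<in> carrier_mat k k. A * B = 1\<^sub>m k"
proof -
  obtain B where B: "A * B = 1\<^sub>m k" "B * A = 1\<^sub>m (dim_row B)"
    using inv A unfolding invertible_mat_def inverts_mat_def by auto
  have "dim_col B = k" using arg_cong[OF B(1), of dim_col] by simp
  moreover have "dim_row B = k" using arg_cong[OF B(2), of dim_col] A by simp
  ultimately show ?thesis using B(1) by blast
qed

lemma mat_op_quotient:
  assumes q: "0 < q" and X: "X \<in> carrier_mat q q" and Y: "Y \<in> carrier_mat q q"
    and ex: "\<exists>B \<in> carrier_mat q q. Y * B = 1\<^sub>m q" and eq: "mat_op q X = mat_op q Y * x"
  shows "mat_op q (minv Y * X) = x"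
proof -
  note inv = minv_inverse[OF Y ex]
  have "mat_op q (minv Y) * mat_op q Y = 1"
    using mat_op_mult[OF q inv(1) Y] inv(3) by (simp add: mat_op_one[OF q])
  then show ?thesis
    by (simp add: mat_op_mult[OF q inv(1) X] eq mult.assoc[symmetric])
qed

lemma scalar_op_sandwich: "scalar_op u * (f * scalar_op v) = scalar_op (u * v) * f"
  by (simp add: scalar_op_mult scalar_op_central[of v f] mult.assoc)

lemma scalar_op_mult_left: "scalar_op u * (scalar_op v * f) = scalar_op (u * v) * f"
  by (simp add: scalar_op_mult mult.assoc)

context moment_data
begin

text \<open>The value formula excludes \<open>k = 0\<close>: l_{-1} = s_0 is not an increment of
  \<open>rows.L\<close> but the initial value \<open>rows.G 0 rows.\<theta>\<close>.\<close>

lemma lbf: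
  assumes "k \<le> n"
  shows "lbf q a b s (int k - 1) \<in> carrier_mat q q" "hermitian_mat (lbf q a b s (int k - 1))"
    and "0 < k \<Longrightarrow> mat_op q (lbf q a b s (int k - 1)) = rows.L k - rows.L (k - 1)"
proof -
  consider "k = 0" | "k = 1" | j where "k = Suc (Suc j)"
    by (metis One_nat_def not0_implies_Suc)
  then have "lbf q a b s (int k - 1) \<in> carrier_mat q q \<and> hermitian_mat (lbf q a b s (int k - 1)) \<and>
    (0 < k \<longrightarrow> mat_op q (lbf q a b s (int k - 1)) = rows.L k - rows.L (k - 1))"
  proof cases
    case 1
    then show ?thesis using s_herm[of 0] by (simp add: lbf_def)
  next
    case 2
    then show ?thesis using lam[of 0] n by (simp add: lbf_def rows.L_def[of 0] row_dot_def)
  next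
    case 3
    then have lt: "Suc j < n" "j < n" using assms by auto
    then show ?thesis
      using lam[OF lt(1)] lam[OF lt(2)] 3
      by (simp add: lbf_def nat_add_distrib mat_op_diff[OF q_pos] hermitian_mat_diff minus_carrier_mat)
  qed
  then show "lbf q a b s (int k - 1) \<in> carrier_mat q q" "hermitian_mat (lbf q a b s (int k - 1))"
    "0 < k \<Longrightarrow> mat_op q (lbf q a b s (int k - 1)) = rows.L k - rows.L (k - 1)" by blast+
qed

lemma mbf:
  assumes "k < n"
  shows "mbf q a b s k \<in> carrier_mat q q" "hermitian_mat (mbf q a b s k)"
    and "mat_op q (mbf q a b s k) = rows.M (Suc k) - rows.M k"
proof -
  have "mbf q a b s k \<in> carrier_mat q q \<and> hermitian_mat (mbf q a b s k) \<and>
    mat_op q (mbf q a b s k) = rows.M (Suc k) - rows.M k"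
  proof (cases k)
    case 0
    then show ?thesis using mu[of 0] n by (simp add: mbf_def rows.M_def[of 0] row_dot_def)
  next
    case (Suc j)
    then show ?thesis
      using mu[of k] mu[of j] assms by (simp add: mbf_def mat_op_diff[OF q_pos] hermitian_mat_diff minus_carrier_mat)
  qed
  then show "mbf q a b s k \<in> carrier_mat q q" "hermitian_mat (mbf q a b s k)"
    "mat_op q (mbf q a b s k) = rows.M (Suc k) - rows.M k" by blast+
qed

definition L_factor :: "nat \<Rightarrow> complex mat" where
  "L_factor k = blk2 (1\<^sub>m q) ((z - complex_of_real a) \<cdot>\<^sub>m lbf q a b s (int k - 1)) (0\<^sub>m q q) (1\<^sub>m q)"

definition M_factor :: "nat \<Rightarrow> complex mat" where
  "M_factor k = blk2 (1\<^sub>m q) (0\<^sub>m q q) (- mbf q a b s k) (1\<^sub>m q)"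

lemma L_factor:
  assumes "k \<le> n"
  shows "L_factor k \<in> carrier_mat (2 * q) (2 * q)"
    "block_op q (mat_adjoint (L_factor k)) 0 0 = 1"
    "block_op q (mat_adjoint (L_factor k)) 0 (Suc 0) = 0"
    "block_op q (mat_adjoint (L_factor k)) (Suc 0) 0 =
      (\<omega> - \<alpha>) * mat_op q (lbf q a b s (int k - 1))"
    "block_op q (mat_adjoint (L_factor k)) (Suc 0) (Suc 0) = 1"
  using lbf(1,2)[OF assms]
  by (simp_all add: L_factor_def blk2_carrier block_op_adjoint_blk2[OF q_pos] mat_op_one[OF q_pos]
      mat_op_zero[OF q_pos] mat_adjoint_smult mat_op_smult[OF q_pos] hermitian_mat_def scalar_op_diff)

lemma M_factor:
  assumes "k < n"
  shows "M_factor k \<in> carrier_mat (2 * q) (2 * q)"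
    "block_op q (mat_adjoint (M_factor k)) 0 0 = 1"
    "block_op q (mat_adjoint (M_factor k)) 0 (Suc 0) = - (rows.M (Suc k) - rows.M k)"
    "block_op q (mat_adjoint (M_factor k)) (Suc 0) 0 = 0"
    "block_op q (mat_adjoint (M_factor k)) (Suc 0) (Suc 0) = 1"
  using mbf[OF assms]
  by (simp_all add: M_factor_def blk2_carrier block_op_adjoint_blk2[OF q_pos] mat_op_one[OF q_pos]
      mat_op_zero[OF q_pos] mat_adjoint_uminus mat_op_uminus[OF q_pos] hermitian_mat_def)

text \<open>The trailing upper factor is kept so that block row 0 of the adjoint is governed by
  \<open>F_row k\<close> and block row 1 by \<open>E_row k\<close>, with the same index
  \<open>k\<close>.\<close>

definition factor_prod :: "nat \<Rightarrow> complex mat" where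
  "factor_prod k = mat_prod_list (2 * q) (map (\<lambda>k. L_factor k * M_factor k) [0..<k]) * L_factor k"

lemma factor_prod_0: "factor_prod 0 = L_factor 0"
  using L_factor(1)[of 0] by (simp add: factor_prod_def mat_prod_list_def)

lemma factor_list_carrier:
  assumes "k \<le> n"
  shows "set (map (\<lambda>k. L_factor k * M_factor k) [0..<k]) \<subseteq> carrier_mat (2 * q) (2 * q)"
  using assms by (auto intro!: mult_carrier_mat[OF L_factor(1) M_factor(1)])

lemma mult_factor_prod:
  assumes D: "D \<in> carrier_mat (2 * q) (2 * q)"
  shows "D * factor_prod n =
    D * mat_prod_list (2 * q) (map (\<lambda>k. L_factor k * M_factor k) [0..<n]) * L_factor n"
  unfolding factor_prod_def
  by (rule assoc_mult_mat[OF D mat_prod_list_snoc(1)[OF factor_list_carrier one_carrier_mat]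
        L_factor(1), symmetric]) simp_all

lemma factor_prod_Suc:
  assumes k: "k < n"
  shows "factor_prod (Suc k) = factor_prod k * M_factor k * L_factor (Suc k)"
proof -
  note L = L_factor(1)[OF less_imp_le[OF k]] and M = M_factor(1)[OF k]
  note P = mat_prod_list_snoc[OF factor_list_carrier[OF less_imp_le[OF k]] mult_carrier_mat[OF L M]]
  show ?thesis
    using P(2) assoc_mult_mat[OF P(1) L M] by (simp add: factor_prod_def)
qed

lemma factor_prod_blocks:
  assumes "k \<le> n"
  shows "factor_prod k \<in> carrier_mat (2 * q) (2 * q) \<and>
    block_op q (mat_adjoint (factor_prod k)) 0 0 = rows.Q k \<and>
    block_op q (mat_adjoint (factor_prod k)) 0 (Suc 0) = - rows.P k \<and>
    block_op q (mat_adjoint (factor_prod k)) (Suc 0) 0 = (\<omega> - \<alpha>) * rows.G k rows.\<theta> \<and>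
    block_op q (mat_adjoint (factor_prod k)) (Suc 0) (Suc 0) = rows.G k (\<lambda>l. \<omega> ^ l)"
  using assms
proof (induction k)
  case 0
  have "lbf q a b s (int 0 - 1) = s 0" by (simp add: lbf_def)
  then show ?case
    using L_factor[of 0]
    by (simp add: factor_prod_0 rows.Q_0 rows.P_0 rows.G_\<theta>_0 rows.G_power_0)
next
  case (Suc k)
  then have k: "k < n" by simp
  let ?X = "factor_prod k" and ?l = "rows.L (Suc k) - rows.L k" and ?m = "rows.M (Suc k) - rows.M k"
  note X = Suc.IH[OF less_imp_le[OF k]]
  have XM: "?X * M_factor k \<in> carrier_mat (2 * q) (2 * q)"
    using X M_factor(1)[OF k] by (intro mult_carrier_mat) auto
  have l: "mat_op q (lbf q a b s (int (Suc k) - 1)) = ?l"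
    using lbf(3)[OF Suc.prems] by simp
  \<comment> \<open>The lower factor updates block row 0 only, by means of the old block row 1. The
    upper factor that follows uses the updated row 0, which is why the recurrences for
    \<open>rows.G\<close> contain \<open>F (Suc k)\<close>.\<close>
  have Y: "block_op q (mat_adjoint (?X * M_factor k)) 0 0 = rows.Q (Suc k)"
    "block_op q (mat_adjoint (?X * M_factor k)) 0 (Suc 0) = - rows.P (Suc k)"
    "block_op q (mat_adjoint (?X * M_factor k)) (Suc 0) 0 = (\<omega> - \<alpha>) * rows.G k rows.\<theta>"
    "block_op q (mat_adjoint (?X * M_factor k)) (Suc 0) (Suc 0) = rows.G k (\<lambda>l. \<omega> ^ l)"
    using X
    by (simp_all add: block_op_adjoint_mult[OF q_pos _ M_factor(1)[OF k]] M_factor[OF k]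
        rows.Q_step[OF k] rows.P_step[OF k] left_diff_distrib)
  show ?case
    unfolding factor_prod_Suc[OF k]
    using mult_carrier_mat[OF XM L_factor(1)[OF Suc.prems]]
    by (simp add: block_op_adjoint_mult[OF q_pos XM L_factor(1)[OF Suc.prems]]
        L_factor(2-)[OF Suc.prems] Y l[simplified] rows.G_\<theta>_step[OF k] rows.G_power_step[OF k]
        distrib_left mult.assoc)
qed

text \<open>Hermitian symmetry is not visible in the quotient. It follows because
  \<open>J_row\<close> evaluated at \<open>a\<close> is minus the quadratic form of the inverse of
  H_{1,n} at the column of powers of \<open>a\<close>.\<close>

lemma The2_inverse_Gam2:
  assumes ex: "\<exists>B \<in> carrier_mat q q. The2 q a s n (complex_of_real a) * B = 1\<^sub>m q"
  defines "W \<equiv> minv (The2 q a s n (complex_of_real a)) * Gam2 q a s n (complex_of_real a)"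
  shows "W \<in> carrier_mat q q" "hermitian_mat W"
    and "mat_op q W = row_dot (Suc n) J_row (\<lambda>l. \<alpha> ^ l)"
proof -
  show W: "W \<in> carrier_mat q q"
    unfolding W_def using minv_inverse(1)[OF carriers(4) ex] carriers(3) by (rule mult_carrier_mat)
  show W_op: "mat_op q W = row_dot (Suc n) J_row (\<lambda>l. \<alpha> ^ l)"
    unfolding W_def
    by (rule mat_op_quotient[OF q_pos carriers(3,4) ex]) (simp only: mat_op_Gam2 tau_factor)
  let ?g = "\<lambda>i. complex_of_real a ^ i \<cdot>\<^sub>m 1\<^sub>m q"
  let ?V = "blk_col q (Suc n) ?g"
  let ?B = "mat_adjoint ?V * minv (blk_hankel q s n) * ?V"
  have g: "?g i \<in> carrier_mat q q \<and> hermitian_mat (?g i)" for i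
    by (simp add: hermitian_mat_def mat_adjoint_smult)
  have pd: "posdef_mat (blk_hankel q s n)" using pd_H1 by (simp add: H1_def)
  note form = mat_op_quadratic_form[OF q_pos pd, of ?g, OF g]
  have "mat_op q (?g i) = \<alpha> ^ i" for i
    by (simp add: mat_op_smult[OF q_pos] mat_op_one[OF q_pos] scalar_op_power)
  then have "mat_op q (- ?B) = mat_op q W"
    using form(1) form(3)
    by (simp add: mat_op_uminus[OF q_pos] W_op J_row_def hankel_row_uminus[OF q_pos]
        row_dot_uminus_left)
  then have "- ?B = W"
    using form(3) W by (intro mat_op_inject[OF q_pos]) simp_all
  then show "hermitian_mat W"
    using hermitian_mat_uminus[OF form(2)] by simp
qed

lemma U2n_factorisation:
  assumes inv_The2: "invertible_mat (The2 q a s n (complex_of_real a))"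
    and za: "z \<noteq> complex_of_real a" and zb: "z \<noteq> complex_of_real b"
  shows "U2n q a b s n z =
    blk2 ((1 / ((complex_of_real b - z) * (z - complex_of_real a))) \<cdot>\<^sub>m 1\<^sub>m q) (0\<^sub>m q q)
         (0\<^sub>m q q) (1\<^sub>m q)
    * factor_prod n
    * blk2 (1\<^sub>m q) (0\<^sub>m q q)
         (minv (Q2 q a b s (n - 1) (complex_of_real a)) * P2 q a b s (n - 1) (complex_of_real a)
          + complex_of_real (1 / (b - a)) \<cdot>\<^sub>m
              (minv (The2 q a s n (complex_of_real a)) * Gam2 q a s n (complex_of_real a)))
         (1\<^sub>m q)
    * blk2 ((complex_of_real (b - a) * (z - complex_of_real a)) \<cdot>\<^sub>m 1\<^sub>m q) (0\<^sub>m q q)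
         (0\<^sub>m q q) (((complex_of_real b - z) / complex_of_real (b - a)) \<cdot>\<^sub>m 1\<^sub>m q)"
    (is "_ = ?D * factor_prod n * blk2 _ _ ?S _ * ?E")
proof -
  let ?\<Theta> = "The2 q a s n (complex_of_real a)" and ?\<Gamma> = "Gam1 q b s n (complex_of_real a)"
  let ?N = "factor_prod n" and ?B = "blk2 (1\<^sub>m q) (0\<^sub>m q q) ?S (1\<^sub>m q)"
  let ?w = "cnj z" and ?a = "complex_of_real a" and ?b = "complex_of_real b"
  define \<delta> where "\<delta> = complex_of_real (b - a)"
  have \<delta>: "\<delta> \<noteq> 0" "\<delta> = ?b - ?a" using ab by (simp_all add: \<delta>_def)
  \<comment> \<open>Since \<open>a\<close> and \<open>b\<close> are real, \<open>cnj z\<close>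
    avoids them exactly when \<open>z\<close> does.\<close>
  have w: "?w - ?a \<noteq> 0" "?b - ?w \<noteq> 0"
    using za zb by (metis complex_cnj_cnj complex_cnj_complex_of_real eq_iff_diff_eq_0)+
  have exT: "\<exists>B \<in> carrier_mat q q. ?\<Theta> * B = 1\<^sub>m q"
    by (rule invertible_mat_right_inverse[OF carriers(4) inv_The2])
  note exG = Gam1_right_inverse
  note W = The2_inverse_Gam2[OF exT]
  have mun: "n - 1 < n" using n by simp
  note mu = mu[OF mun]
  have S: "?S \<in> carrier_mat q q" "hermitian_mat ?S"
    unfolding Q2_inverse_P2
    by (rule add_carrier_mat[OF smult_carrier_mat[OF W(1)]])
      (rule hermitian_mat_add[OF mu(3) smult_carrier_mat[OF W(1)] mu(2) hermitian_mat_smult[OF W(2)]])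
  have "mat_op q ?S = rows.M n + scalar_op (1 / \<delta>) * row_dot (Suc n) J_row (\<lambda>l. \<alpha> ^ l)"
    unfolding Q2_inverse_P2 using W mu n
    by (simp add: mat_op_add[OF q_pos] mat_op_smult[OF q_pos] \<delta>_def)
  then have S_op: "scalar_op \<delta> * (mat_op q ?S * x) = rows.S * x" for x
    using \<delta> by (simp add: rows.S_def scalar_op_mult_left distrib_left distrib_right
        scalar_op_diff[symmetric] mult.assoc[symmetric] scalar_op_mult[symmetric])

  have U: "mat_adjoint (U2n q a b s n z) = blk2 (minv ?\<Theta> * The2 q a s n ?w)
      ((?w - ?a) \<cdot>\<^sub>m (minv ?\<Theta> * Gam2 q a s n ?w))
      ((1 / \<delta>) \<cdot>\<^sub>m (minv ?\<Gamma> * The1 q b s n ?w)) (((?b - ?w) / \<delta>) \<cdot>\<^sub>m (minv ?\<Gamma> * Gam1 q b s n ?w))"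
    unfolding U2n_def
    by (subst mat_adjoint_four_block_mat[of _ q])
      (simp_all add: mat_adjoint_smult \<delta>_def mat_adjoint_quotient[OF carriers(1) carriers(1) exG]
        mat_adjoint_quotient[OF carriers(2) carriers(1) exG]
        mat_adjoint_quotient[OF carriers(3) carriers(4) exT]
        mat_adjoint_quotient[OF carriers(4) carriers(4) exT])
  have quot_carrier: "minv ?\<Theta> * X \<in> carrier_mat q q" "minv ?\<Gamma> * X \<in> carrier_mat q q"
    if "X \<in> carrier_mat q q" for X
    using that mult_carrier_mat[OF minv_inverse(1)[OF carriers(4) exT] that]
      mult_carrier_mat[OF minv_inverse(1)[OF carriers(1) exG] that] by auto
  have U_carrier: "mat_adjoint (U2n q a b s n z) \<in> carrier_mat (2 * q) (2 * q)"
    unfolding U by (intro blk2_carrier smult_carrier_mat quot_carrier carriers)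
  have U_entries:
    "mat_op q (minv ?\<Theta> * The2 q a s n ?w) = row_dot (Suc n) J_row rows.t"
    "mat_op q (minv ?\<Theta> * Gam2 q a s n ?w) = row_dot (Suc n) J_row (\<lambda>l. \<omega> ^ l)"
    "mat_op q (minv ?\<Gamma> * The1 q b s n ?w) = rows.G n rows.\<theta>"
    "mat_op q (minv ?\<Gamma> * Gam1 q b s n ?w) = rows.G n (\<lambda>l. \<omega> ^ l)"
    by (rule mat_op_quotient[OF q_pos carriers(4,4) exT], simp only: mat_op_The2 tau_factor)
      (rule mat_op_quotient[OF q_pos carriers(3,4) exT], simp only: mat_op_Gam2 tau_factor,
       rule mat_op_quotient[OF q_pos carriers(2,1) exG Gam1_factor(2)],
       rule mat_op_quotient[OF q_pos carriers(1,1) exG Gam1_factor(1)])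
  have U_blocks: "block_op q (mat_adjoint (U2n q a b s n z)) 0 0 = row_dot (Suc n) J_row rows.t"
    "block_op q (mat_adjoint (U2n q a b s n z)) 0 (Suc 0) =
      scalar_op (?w - ?a) * row_dot (Suc n) J_row (\<lambda>l. \<omega> ^ l)"
    "block_op q (mat_adjoint (U2n q a b s n z)) (Suc 0) 0 = scalar_op (1 / \<delta>) * rows.G n rows.\<theta>"
    "block_op q (mat_adjoint (U2n q a b s n z)) (Suc 0) (Suc 0) =
      scalar_op ((?b - ?w) / \<delta>) * rows.G n (\<lambda>l. \<omega> ^ l)"
    unfolding U
    by (simp_all add: block_op_four_block_mat[OF q_pos] quot_carrier carriers mat_op_smult[OF q_pos]
        U_entries)

  note N = factor_prod_blocks[OF order_refl]
  have D: "?D \<in> carrier_mat (2 * q) (2 * q)" and B: "?B \<in> carrier_mat (2 * q) (2 * q)"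
    and E: "?E \<in> carrier_mat (2 * q) (2 * q)"
    using S by (intro blk2_carrier; simp)+
  have DN: "?D * ?N \<in> carrier_mat (2 * q) (2 * q)"
    using D N by (intro mult_carrier_mat) auto
  have DNB: "?D * ?N * ?B \<in> carrier_mat (2 * q) (2 * q)" by (rule mult_carrier_mat[OF DN B])
  let ?d = "1 / ((?b - ?w) * (?w - ?a))"
  have D_blocks: "block_op q (mat_adjoint ?D) 0 0 = scalar_op ?d"
    "block_op q (mat_adjoint ?D) 0 (Suc 0) = 0" "block_op q (mat_adjoint ?D) (Suc 0) 0 = 0"
    "block_op q (mat_adjoint ?D) (Suc 0) (Suc 0) = 1"
    by (simp_all add: block_op_adjoint_blk2[OF q_pos] mat_adjoint_smult mat_op_smult[OF q_pos]
        mat_op_one[OF q_pos] mat_op_zero[OF q_pos])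
  have B_blocks: "block_op q (mat_adjoint ?B) 0 0 = 1"
    "block_op q (mat_adjoint ?B) 0 (Suc 0) = mat_op q ?S" "block_op q (mat_adjoint ?B) (Suc 0) 0 = 0"
    "block_op q (mat_adjoint ?B) (Suc 0) (Suc 0) = 1"
    using S(2)
    by (simp_all only: block_op_adjoint_blk2[OF q_pos one_carrier_mat zero_carrier_mat S(1) one_carrier_mat]
        mat_adjoint_one mat_adjoint_zero mat_op_one[OF q_pos] mat_op_zero[OF q_pos] hermitian_mat_def)
  have E_blocks: "block_op q (mat_adjoint ?E) 0 0 = scalar_op (\<delta> * (?w - ?a))"
    "block_op q (mat_adjoint ?E) 0 (Suc 0) = 0" "block_op q (mat_adjoint ?E) (Suc 0) 0 = 0"
    "block_op q (mat_adjoint ?E) (Suc 0) (Suc 0) = scalar_op ((?b - ?w) / \<delta>)"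
    by (simp_all add: block_op_adjoint_blk2[OF q_pos] mat_adjoint_smult mat_op_smult[OF q_pos]
        mat_op_one[OF q_pos] mat_op_zero[OF q_pos] \<delta>_def)
  let ?R = "?D * ?N * ?B * ?E"
  have DN_blocks: "block_op q (mat_adjoint (?D * ?N)) i 0 = block_op q (mat_adjoint ?N) i 0 * scalar_op ?d"
    "block_op q (mat_adjoint (?D * ?N)) i (Suc 0) = block_op q (mat_adjoint ?N) i (Suc 0)" if "i < 2" for i
    using that N D by (simp_all only: block_op_adjoint_mult[OF q_pos] D_blocks) simp_all
  have DNB_blocks: "block_op q (mat_adjoint (?D * ?N * ?B)) 0 j = block_op q (mat_adjoint (?D * ?N)) 0 j
        + mat_op q ?S * block_op q (mat_adjoint (?D * ?N)) (Suc 0) j"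
    "block_op q (mat_adjoint (?D * ?N * ?B)) (Suc 0) j = block_op q (mat_adjoint (?D * ?N)) (Suc 0) j"
    if "j < 2" for j
    using block_op_adjoint_mult[OF q_pos DN B, of 0 j] block_op_adjoint_mult[OF q_pos DN B, of "Suc 0" j]
      that by (simp_all only: B_blocks) simp_all
  have R_blocks: "block_op q (mat_adjoint ?R) 0 j =
        scalar_op (\<delta> * (?w - ?a)) * block_op q (mat_adjoint (?D * ?N * ?B)) 0 j"
    "block_op q (mat_adjoint ?R) (Suc 0) j =
        scalar_op ((?b - ?w) / \<delta>) * block_op q (mat_adjoint (?D * ?N * ?B)) (Suc 0) j"
    if "j < 2" for j
    using block_op_adjoint_mult[OF q_pos DNB E, of 0 j] block_op_adjoint_mult[OF q_pos DNB E, of "Suc 0" j]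
      that by (simp_all only: E_blocks) simp_all

  \<comment> \<open>The scalar of the first diagonal factor ends up rightmost in the adjoint and is
    moved to the left because scalars are central. It cancels w - a, and the remaining 1/(b - w)
    cancels the b - w of \<open>rows.S_G_\<theta>\<close>.\<close>
  have "block_op q (mat_adjoint ?R) 0 0 = block_op q (mat_adjoint (U2n q a b s n z)) 0 0"
  proof -
    let ?Y = "rows.Q n + mat_op q ?S * ((\<omega> - \<alpha>) * rows.G n rows.\<theta>)"
    have "block_op q (mat_adjoint ?R) 0 0 = scalar_op (\<delta> * (?w - ?a)) * (?Y * scalar_op ?d)"
      using N by (simp only: R_blocks DNB_blocks DN_blocks zero_less_numeral Suc_1[symmetric] lessI)
        (simp only: distrib_right mult.assoc)
    also have "\<dots> = scalar_op (\<delta> * (?w - ?a) * ?d) * ?Y"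
      by (rule scalar_op_sandwich)
    also have "\<delta> * (?w - ?a) * ?d = 1 / (?b - ?w) * \<delta>"
    proof -
      have "\<delta> * u * (1 / (v * u)) = 1 / v * \<delta>" if "u \<noteq> 0" "v \<noteq> 0" for u v :: complex
        using that by (simp add: field_simps)
      then show ?thesis using w by blast
    qed
    also have "scalar_op (1 / (?b - ?w) * \<delta>) * ?Y = scalar_op (1 / (?b - ?w)) * (scalar_op \<delta> * ?Y)"
      by (rule scalar_op_mult_left[symmetric])
    also have "scalar_op \<delta> * ?Y = scalar_op (?b - ?w) * row_dot (Suc n) J_row rows.t"
      unfolding distrib_left S_op using rows.S_G_\<theta> by (simp only: \<delta>(2) scalar_op_diff)
    also have "scalar_op (1 / (?b - ?w)) * \<dots> = row_dot (Suc n) J_row rows.t"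
      unfolding scalar_op_mult_left using w by simp
    finally show ?thesis by (simp only: U_blocks)
  qed
  moreover have "block_op q (mat_adjoint ?R) 0 (Suc 0) =
      block_op q (mat_adjoint (U2n q a b s n z)) 0 (Suc 0)"
  proof -
    let ?Y = "- rows.P n + mat_op q ?S * rows.G n (\<lambda>l. \<omega> ^ l)"
    have "block_op q (mat_adjoint ?R) 0 (Suc 0) = scalar_op (\<delta> * (?w - ?a)) * ?Y"
      using N by (simp only: R_blocks DNB_blocks DN_blocks zero_less_numeral Suc_1[symmetric] lessI)
    also have "\<dots> = scalar_op (?w - ?a) * (scalar_op \<delta> * ?Y)"
      by (simp only: scalar_op_mult_left mult.commute[of \<delta>])
    also have "scalar_op \<delta> * ?Y = row_dot (Suc n) J_row (\<lambda>l. \<omega> ^ l)"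
      unfolding distrib_left S_op using rows.S_G_power by (simp add: \<delta>(2) scalar_op_diff)
    finally show ?thesis by (simp only: U_blocks)
  qed
  moreover have "block_op q (mat_adjoint ?R) (Suc 0) 0 =
      block_op q (mat_adjoint (U2n q a b s n z)) (Suc 0) 0"
  proof -
    have "block_op q (mat_adjoint ?R) (Suc 0) 0 =
        scalar_op ((?b - ?w) / \<delta>) * ((\<omega> - \<alpha>) * rows.G n rows.\<theta> * scalar_op ?d)"
      using N by (simp only: R_blocks DNB_blocks DN_blocks zero_less_numeral Suc_1[symmetric] lessI)
    also have "\<dots> = scalar_op ((?b - ?w) / \<delta> * ?d * (?w - ?a)) * rows.G n rows.\<theta>"
      by (simp only: scalar_op_sandwich scalar_op_mult_left scalar_op_diff[symmetric])
    also have "(?b - ?w) / \<delta> * ?d * (?w - ?a) = 1 / \<delta>"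
    proof -
      have "v / \<delta> * (1 / (v * u)) * u = 1 / \<delta>" if "u \<noteq> 0" "v \<noteq> 0" for u v :: complex
        using that by (simp add: field_simps)
      then show ?thesis using w by blast
    qed
    finally show ?thesis by (simp only: U_blocks)
  qed
  moreover have "block_op q (mat_adjoint ?R) (Suc 0) (Suc 0) =
      block_op q (mat_adjoint (U2n q a b s n z)) (Suc 0) (Suc 0)"
    using N by (simp only: R_blocks DNB_blocks DN_blocks U_blocks zero_less_numeral Suc_1[symmetric] lessI)
  ultimately have "block_op q (mat_adjoint ?R) i j = block_op q (mat_adjoint (U2n q a b s n z)) i j"
    if "i < 2" "j < 2" for i j
    using that by (auto simp: numeral_2_eq_2 less_Suc_eq)
  then have "mat_adjoint ?R = mat_adjoint (U2n q a b s n z)"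
    using mat_adjoint_carrier[OF mult_carrier_mat[OF DNB E]] U_carrier
    by (intro block_op_eqI[OF q_pos, of _ 2 2]) auto
  then show ?thesis by (metis mat_adjoint_adjoint)
qed

end

theorem mainTheorem6:
  fixes q n :: nat and a b :: real and s :: "nat \<Rightarrow> complex mat" and z :: complex
  assumes q: "q \<ge> 1" and n: "n \<ge> 1" and ab: "a < b"
    and s_herm: "\<And>j. j \<le> 2 * n + 1 \<Longrightarrow> s j \<in> carrier_mat q q \<and> hermitian_mat (s j)"
    and pd_H1: "posdef_mat (H1 q s n)"
    and pd_H2: "posdef_mat (H2 q a b s (n - 1))"
    and pd_K1: "posdef_mat (K1 q b s n)"
    and pd_K2: "posdef_mat (K2 q a s n)"
    and inv_The2: "invertible_mat (The2 q a s n (complex_of_real a))"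
    and za: "z \<noteq> complex_of_real a" and zb: "z \<noteq> complex_of_real b"
  shows "U2n q a b s n z =
    blk2 ((1 / ((complex_of_real b - z) * (z - complex_of_real a))) \<cdot>\<^sub>m 1\<^sub>m q) (0\<^sub>m q q)
         (0\<^sub>m q q) (1\<^sub>m q)
    * mat_prod_list (2 * q)
        (map (\<lambda>k. blk2 (1\<^sub>m q) ((z - complex_of_real a) \<cdot>\<^sub>m lbf q a b s (int k - 1))
                        (0\<^sub>m q q) (1\<^sub>m q)
                 * blk2 (1\<^sub>m q) (0\<^sub>m q q) (- mbf q a b s k) (1\<^sub>m q))
             [0..<n])
    * blk2 (1\<^sub>m q) ((z - complex_of_real a) \<cdot>\<^sub>m lbf q a b s (int n - 1)) (0\<^sub>m q q) (1\<^sub>m q)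
    * blk2 (1\<^sub>m q) (0\<^sub>m q q)
         (minv (Q2 q a b s (n - 1) (complex_of_real a)) * P2 q a b s (n - 1) (complex_of_real a)
          + complex_of_real (1 / (b - a)) \<cdot>\<^sub>m
              (minv (The2 q a s n (complex_of_real a)) * Gam2 q a s n (complex_of_real a)))
         (1\<^sub>m q)
    * blk2 ((complex_of_real (b - a) * (z - complex_of_real a)) \<cdot>\<^sub>m 1\<^sub>m q) (0\<^sub>m q q)
         (0\<^sub>m q q) (((complex_of_real b - z) / complex_of_real (b - a)) \<cdot>\<^sub>m 1\<^sub>m q)"
proof -
  interpret moment_data q n a b s z
    using q n ab s_herm pd_H1 pd_H2 pd_K1 pd_K2 by unfold_locales
  show ?thesis
    unfolding U2n_factorisation[OF inv_The2 za zb]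
    by (subst mult_factor_prod) (simp_all add: blk2_carrier L_factor_def M_factor_def)
qed

end
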